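(* Let $\mathcal X$ be a countable domain. Assume that $\mathcal H\subseteq\{0,1\}^{\mathcal X}$ is learnable by an $(\alpha,\beta)$-accurate $\rho$-TV indistinguishable learner $A$, for some $\rho\in(0,1)$, $\alpha\in(0,1/2)$, $\beta\in\left(0,\frac{1-\rho}{1+\rho}\right)$. Then, for any $(\alpha',\beta',\varepsilon,\delta)\in(0,1)^4$, $\mathcal H$ is also learnable by an $(\alpha+\alpha',\beta')$-accurate $(\varepsilon,\delta)$-differentially private learner $A'$.
   Context: An $n$-sample learning rule (learner) is a randomized map $A:(\mathcal X\times\{0,1\})^n\to\{0,1\}^{\mathcal X}$; $A(S)$ denotes the distribution of its output on $S$. For a distribution $\mathcal D$ over $\mathcal X\times\{0,1\}$, $\mathrm{err}_{\mathcal D}(h)=\Pr_{(x,y)\sim\mathcal D}[h(x)\ne y]$. $\mathcal D$ is realizable with respect to $\mathcal H$ if some $h^*\in\mathcal H$ has $\mathrm{err}_{\mathcal D}(h^* )=0$. $A$ is $n$-sample $(\alpha,\beta)$-accurate for $\mathcal H$ if for every realizable $\mathcal D$, $\Pr_{S\sim\mathcal D^n,\,h\sim A(S)}[\mathrm{err}_{\mathcal D}(h)>\alpha]\le\beta$. "$\mathcal H$ is learnable by" a learner with certain properties means that, for some finite sample size, such a learner exists, accurate for $\mathcal H$. $A$ is $n$-sample $(\varepsilon,\delta)$-differentially private if for every $S,S'\in(\mathcal X\times\{0,1\})^n$ differing in a single example and every measurable event $E$, $\Pr[A(S)\in E]\le e^{\varepsilon}\Pr[A(S')\in E]+\delta$.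 $A$ is $n$-sample $\rho$-TV indistinguishable if for every distribution $\mathcal D$ over $\mathcal X\times\{0,1\}$ and independent $S,S'\sim\mathcal D^n$, $\mathbf E_{S,S'}[d_{\mathrm{TV}}(A(S),A(S'))]\le\rho$. *)

theory Defs
  imports "HOL-Probability.Probability"
begin

text \<open>
  The domain is a type of class \<^class>\<open>countable\<close>, taken with its discrete sigma-algebra, so
  that distributions over labelled examples are exactly the values of type
  \<open>('a \<times> bool) pmf\<close>. A sample of size \<open>n\<close> is a list of length \<open>n\<close>.
\<close>

text \<open>Measurable events of hypotheses are those of the product sigma-algebra on \<open>{0,1}\<^sup>X\<close>.\<close>

definition hyp_space :: "('a \<Rightarrow> bool) measure" where
  "hyp_space = Pi\<^sub>M UNIV (\<lambda>_. count_space UNIV)"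

text \<open>
  A randomized map is represented by its output distributions. Only the values on lists of
  length \<open>n\<close> matter; these are countably many, so measurability in the sample is automatic.
\<close>

definition learner :: "nat \<Rightarrow> (('a::countable \<times> bool) list \<Rightarrow> ('a \<Rightarrow> bool) measure) \<Rightarrow> bool" where
  "learner n A \<longleftrightarrow> (\<forall>S. length S = n \<longrightarrow> A S \<in> space (prob_algebra hyp_space))"

definition err :: "('a \<times> bool) pmf \<Rightarrow> ('a \<Rightarrow> bool) \<Rightarrow> real" where
  "err D h = measure_pmf.prob D {(x, y). h x \<noteq> y}"

definition realizable :: "('a \<Rightarrow> bool) set \<Rightarrow> ('a \<times> bool) pmf \<Rightarrow> bool" where
  "realizable H D \<longleftrightarrow> (\<exists>h\<in>H. err D h = 0)"

text \<open>
  The probability over \<open>S \<sim> D\<^sup>n\<close> and then \<open>h \<sim> A S\<close> is the expectation over \<open>S\<close> of the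
  probability under \<open>A S\<close>.
\<close>

definition accurate ::
  "nat \<Rightarrow> real \<Rightarrow> real \<Rightarrow> ('a::countable \<Rightarrow> bool) set
    \<Rightarrow> (('a \<times> bool) list \<Rightarrow> ('a \<Rightarrow> bool) measure) \<Rightarrow> bool" where
  "accurate n \<alpha> \<beta> H A \<longleftrightarrow>
    (\<forall>D. realizable H D \<longrightarrow>
      measure_pmf.expectation (replicate_pmf n D)
        (\<lambda>S. measure (A S) {h \<in> space (A S). err D h > \<alpha>}) \<le> \<beta>)"

definition diff_private ::
  "nat \<Rightarrow> real \<Rightarrow> real \<Rightarrow> (('a::countable \<times> bool) list \<Rightarrow> ('a \<Rightarrow> bool) measure) \<Rightarrow> bool" where
  "diff_private n \<epsilon> \<delta> A \<longleftrightarrow>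
    (\<forall>S S'. length S = n \<longrightarrow> length S' = n \<longrightarrow> card {i. i < n \<and> S ! i \<noteq> S' ! i} = 1 \<longrightarrow>
      (\<forall>E \<in> sets hyp_space. measure (A S) E \<le> exp \<epsilon> * measure (A S') E + \<delta>))"

text \<open>Meant for two probability measures on the same sigma-algebra.\<close>

definition tv_dist :: "'b measure \<Rightarrow> 'b measure \<Rightarrow> real" where
  "tv_dist M N = (SUP E\<in>sets M. \<bar>measure M E - measure N E\<bar>)"

definition tv_indistinguishable ::
  "nat \<Rightarrow> real \<Rightarrow> (('a::countable \<times> bool) list \<Rightarrow> ('a \<Rightarrow> bool) measure) \<Rightarrow> bool" where
  "tv_indistinguishable n \<rho> A \<longleftrightarrow>
    (\<forall>D. measure_pmf.expectation (pair_pmf (replicate_pmf n D) (replicate_pmf n D))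
      (\<lambda>(S, S'). tv_dist (A S) (A S')) \<le> \<rho>)"

end

theory Submission
  imports Defs
begin

text \<open>
  Let \<open>P\<close> dominate all the output distributions \<open>A S\<close> (there are countably many samples), and
  let \<open>R S\<close> be the region under the graph of the density of \<open>A S\<close>, a set of measure one in the
  possibly infinite measure space \<open>\<mu> = P \<Otimes> lborel\<close>. Two regions overlap in at least
  \<open>1 - d\<^sub>T\<^sub>V\<close>, so for \<open>q x = Pr [x \<in> R S]\<close> the integral of \<open>q\<^sup>2\<close> is at least \<open>1 - \<rho>\<close>, while the
  part of \<open>q\<close> over bad hypotheses integrates to at most \<open>\<beta> < 1 - \<rho>\<close>. Hence for some constant
  \<open>c > 0\<close> the points over good hypotheses with \<open>q > c\<close> have measure between \<open>c\<close> and \<open>1 / c\<close>.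

  The private learner draws \<open>k\<close> samples \<open>S\<^sub>j\<close> and a validation sample \<open>T\<close>, and outputs the
  hypothesis of a point chosen with density proportional to
  \<open>Z 1\<^sub>D + (exp (\<epsilon> s) - 1) w\<close>, where \<open>s\<close> counts the regions \<open>R S\<^sub>j\<close> that contain the
  point, \<open>w\<close> decays exponentially in the excess number of errors on \<open>T\<close>, and \<open>D\<close> has measure
  one. Changing one example multiplies this by at most \<open>exp \<epsilon>\<close>, up to an additive term of integral
  \<open>exp \<epsilon> - 1\<close>, which is small relative to \<open>Z\<close>. For large \<open>k\<close> the heavy good points
  dominate \<open>Z\<close>, and for \<open>T\<close> large compared with \<open>k\<close> the bad points have negligible weight.
\<close>

section \<open>Samples from discrete distributions\<close>

text \<open>The sigma-algebra of a pmf is the full power set, so over a countable sample type joint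
  measurability reduces to measurability of each section.\<close>

lemma measurable_pmf_pair_countable:
  fixes p :: "'s::countable pmf"
  assumes "\<And>s. f s \<in> measurable M N"
  shows "(\<lambda>(s, x). f s x) \<in> measurable (measure_pmf p \<Otimes>\<^sub>M M) N"
proof -
  have "(\<lambda>(s, x). f s x) \<in> measurable (count_space UNIV \<Otimes>\<^sub>M M) N"
    by (rule measurable_pair_measure_countable1) (use assms in auto)
  also have "measurable (count_space UNIV \<Otimes>\<^sub>M M) N = measurable (measure_pmf p \<Otimes>\<^sub>M M) N"
    by (intro measurable_cong_sets sets_pair_measure_cong) auto
  finally show ?thesis .
qed

lemma nn_integral_pmf_swap:
  fixes p :: "'s::countable pmf"
  assumes "sigma_finite_measure M" and "\<And>s. f s \<in> borel_measurable M"
  shows "(\<integral>\<^sup>+s. \<integral>\<^sup>+x. f s x \<partial>M \<partial>measure_pmf p) = (\<integral>\<^sup>+x. \<integral>\<^sup>+s. f s x \<partial>measure_pmf p \<partial>M)"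
proof -
  interpret M: sigma_finite_measure M by fact
  interpret pair_sigma_finite "measure_pmf p" M ..
  show ?thesis
    using Fubini'[of f] measurable_pmf_pair_countable[of f M borel p] assms(2) by simp
qed

lemma borel_measurable_nn_integral_pmf:
  fixes p :: "'s::countable pmf"
  assumes "\<And>s. f s \<in> borel_measurable M"
  shows "(\<lambda>x. \<integral>\<^sup>+s. f s x \<partial>measure_pmf p) \<in> borel_measurable M"
proof -
  have "(\<lambda>(x, s). f s x) \<in> borel_measurable (M \<Otimes>\<^sub>M measure_pmf p)"
    using measurable_pair_swap[OF measurable_pmf_pair_countable[of f M borel p]] assms
    by (simp add: case_prod_unfold)
  then show ?thesis
    by (rule measure_pmf.borel_measurable_nn_integral)
qed

text \<open>The probability is the integral of an indicator over the countable sample type. This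
  serves both for the hit probability of a point and for \<open>err D\<close> as a function of the
  hypothesis.\<close>

lemma borel_measurable_prob_pmf:
  fixes p :: "'s::countable pmf"
  assumes "\<And>s. {x \<in> space M. Q x s} \<in> sets M"
  shows "(\<lambda>x. measure_pmf.prob p {s. Q x s}) \<in> borel_measurable M"
proof -
  have eq: "emeasure (measure_pmf p) {s. Q x s} = (\<integral>\<^sup>+s. (if Q x s then 1 else 0) \<partial>measure_pmf p)" for x
  proof -
    have "emeasure (measure_pmf p) {s. Q x s} = (\<integral>\<^sup>+s. indicator {s. Q x s} s \<partial>measure_pmf p)"
      by simp
    also have "\<dots> = (\<integral>\<^sup>+s. (if Q x s then 1 else 0) \<partial>measure_pmf p)"
      by (intro nn_integral_cong) (simp add: indicator_def)
    finally show ?thesis .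
  qed
  have "(\<lambda>x. \<integral>\<^sup>+s. (if Q x s then 1 else 0) \<partial>measure_pmf p) \<in> borel_measurable M"
    using assms by (intro borel_measurable_nn_integral_pmf measurable_If) auto
  then show ?thesis unfolding measure_def eq by measurable
qed

lemma replicate_pmf_map_pmf:
  "replicate_pmf n (map_pmf f p) = map_pmf (map f) (replicate_pmf n p)"
  by (induction n) (simp_all add: map_pmf_def bind_assoc_pmf bind_return_pmf)

section \<open>Binomial tail bounds for counts in a sample\<close>

lemma map_pmf_length_filter_replicate_pmf:
  "map_pmf (\<lambda>xs. length (filter Q xs)) (replicate_pmf n p)
    = binomial_pmf n (measure_pmf.prob p {x. Q x})"
proof -
  have q: "bernoulli_pmf (measure_pmf.prob p {x. Q x}) = map_pmf Q p"
  proof (rule pmf_eqI)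
    fix b
    have "pmf (map_pmf Q p) b = measure_pmf.prob p {x. Q x = b}"
      by (simp add: pmf_map vimage_def)
    moreover have "measure_pmf.prob p {x. \<not> Q x} = 1 - measure_pmf.prob p {x. Q x}"
      using measure_pmf.prob_compl[of "{x. Q x}" p] by (simp add: set_diff_eq)
    ultimately show "pmf (bernoulli_pmf (measure_pmf.prob p {x. Q x})) b = pmf (map_pmf Q p) b"
      by (cases b) auto
  qed
  have "binomial_pmf n (measure_pmf.prob p {x. Q x})
      = map_pmf (length \<circ> filter id) (replicate_pmf n (map_pmf Q p))"
    by (subst binomial_pmf_altdef) (auto simp: q)
  also have "\<dots> = map_pmf (\<lambda>xs. length (filter Q xs)) (replicate_pmf n p)"
    by (simp add: replicate_pmf_map_pmf pmf.map_comp o_def filter_map)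
  finally show ?thesis by simp
qed

text \<open>Hoeffding's lower tail for the binomial count, stated with a free threshold
  \<open>t\<close> so that it applies to region hits and to validation errors alike.\<close>

lemma prob_length_filter_le:
  fixes e t :: real
  assumes "n > 0" "e \<ge> 0" "real n * measure_pmf.prob p {x. Q x} - e * n \<ge> t"
  shows "measure_pmf.prob (replicate_pmf n p) {xs. real (length (filter Q xs)) \<le> t} \<le> exp (- 2 * real n * e\<^sup>2)"
proof -
  interpret binomial_distribution n "measure_pmf.prob p {x. Q x}" by unfold_locales auto
  have "measure_pmf.prob (replicate_pmf n p) {xs. real (length (filter Q xs)) \<le> t}
      = measure_pmf.prob (map_pmf (\<lambda>xs. length (filter Q xs)) (replicate_pmf n p)) {i. real i \<le> t}"
    by (simp add: vimage_def)
  also have "\<dots> \<le> measure_pmf.prob (binomial_pmf n (measure_pmf.prob p {x. Q x}))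
      {i. i / n \<le> measure_pmf.prob p {x. Q x} - e}"
    unfolding map_pmf_length_filter_replicate_pmf using assms
    by (intro measure_pmf.finite_measure_mono) (auto simp: field_simps)
  also have "\<dots> \<le> exp (- 2 * real n * e\<^sup>2)" using prob_le'[of e] assms by simp
  finally show ?thesis .
qed

text \<open>The matching upper tail of Hoeffding's inequality.\<close>

lemma prob_length_filter_ge:
  fixes e t :: real
  assumes "n > 0" "e \<ge> 0" "real n * measure_pmf.prob p {x. Q x} + e * n \<le> t"
  shows "measure_pmf.prob (replicate_pmf n p) {xs. real (length (filter Q xs)) \<ge> t} \<le> exp (- 2 * real n * e\<^sup>2)"
proof -
  interpret binomial_distribution n "measure_pmf.prob p {x. Q x}" by unfold_locales auto
  have "measure_pmf.prob (replicate_pmf n p) {xs. real (length (filter Q xs)) \<ge> t}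
      = measure_pmf.prob (map_pmf (\<lambda>xs. length (filter Q xs)) (replicate_pmf n p)) {i. real i \<ge> t}"
    by (simp add: vimage_def)
  also have "\<dots> \<le> measure_pmf.prob (binomial_pmf n (measure_pmf.prob p {x. Q x}))
      {i. i / n \<ge> measure_pmf.prob p {x. Q x} + e}"
    unfolding map_pmf_length_filter_replicate_pmf using assms
    by (intro measure_pmf.finite_measure_mono) (auto simp: field_simps)
  also have "\<dots> \<le> exp (- 2 * real n * e\<^sup>2)" using prob_ge'[of e] assms by simp
  finally show ?thesis .
qed

section \<open>Splitting one sample into independent pieces\<close>

lemma replicate_pmf_add_pair:
  "map_pmf (\<lambda>xs. (take m xs, drop m xs)) (replicate_pmf (m + n) p)
    = pair_pmf (replicate_pmf m p) (replicate_pmf n p)"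
proof -
  have "map_pmf (\<lambda>xs. (take m xs, drop m xs)) (replicate_pmf (m + n) p)
      = replicate_pmf m p \<bind> (\<lambda>xs. replicate_pmf n p \<bind> (\<lambda>ys. return_pmf (take m (xs @ ys), drop m (xs @ ys))))"
    by (simp add: replicate_pmf_distrib map_bind_pmf)
  also have "\<dots> = replicate_pmf m p \<bind> (\<lambda>xs. replicate_pmf n p \<bind> (\<lambda>ys. return_pmf (xs, ys)))"
    by (intro bind_pmf_cong refl) (auto simp: set_replicate_pmf)
  finally show ?thesis by (simp add: pair_pmf_def)
qed

text \<open>Blocks are cut out by position, so entry \<open>i\<close> can influence only block
  \<open>i div n\<close>; this locality is what the privacy argument uses.\<close>

definition blocks :: "nat \<Rightarrow> nat \<Rightarrow> 'b list \<Rightarrow> 'b list list" where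
  "blocks n k S = map (\<lambda>j. take n (drop (j * n) S)) [0..<k]"

lemma blocks_Suc: "blocks n (Suc k) S = take n S # blocks n k (drop n S)"
  unfolding blocks_def
  by (simp add: upt_conv_Cons map_Suc_upt[symmetric] add.commute del: upt_Suc)

text \<open>Induction on \<open>k\<close>, peeling off the first block. The remaining
  \<open>m\<close> entries are carried along because they become the validation sample, which has to
  be independent of the blocks.\<close>

lemma replicate_pmf_blocks:
  "map_pmf (\<lambda>S. (blocks n k S, drop (k * n) S)) (replicate_pmf (k * n + m) D)
    = pair_pmf (replicate_pmf k (replicate_pmf n D)) (replicate_pmf m D)"
proof (induction k)
  case 0
  show ?case by (simp add: blocks_def pair_return_pmf1)
next
  case (Suc k)
  have "map_pmf (\<lambda>S. (blocks n (Suc k) S, drop (Suc k * n) S)) (replicate_pmf (Suc k * n + m) D)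
      = map_pmf (\<lambda>(a, S). (a # blocks n k S, drop (k * n) S))
         (map_pmf (\<lambda>S. (take n S, drop n S)) (replicate_pmf (n + (k * n + m)) D))"
    by (simp add: pmf.map_comp o_def blocks_Suc ac_simps)
  also have "\<dots> = replicate_pmf n D \<bind> (\<lambda>a. map_pmf (\<lambda>(b, T). (a # b, T))
       (map_pmf (\<lambda>S. (blocks n k S, drop (k * n) S)) (replicate_pmf (k * n + m) D)))"
    by (simp add: replicate_pmf_add_pair pair_pmf_def map_bind_pmf pmf.map_comp o_def)
      (simp add: map_pmf_def)
  finally show ?case unfolding Suc.IH
    by (simp add: pair_pmf_def map_bind_pmf bind_assoc_pmf bind_return_pmf)
qed

section \<open>Density regions\<close>

text \<open>This is the fibre length of a region over a hypothesis with density \<open>y\<close>.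
  The infinite value is included because Radon-Nikodym derivatives take values in
  \<open>ennreal\<close>.\<close>

lemma emeasure_lborel_below_ennreal:
  "emeasure lborel {t::real. 0 \<le> t \<and> ennreal t < y} = y"
proof (cases y)
  case (real r)
  then have "{t::real. 0 \<le> t \<and> ennreal t < y} = {0..<r}"
    by (auto simp: ennreal_less_iff)
  with real show ?thesis by simp
next
  case top
  have "emeasure lborel {0::real..} = \<infinity>"
  proof (rule ccontr)
    assume "emeasure lborel {0::real..} \<noteq> \<infinity>"
    then obtain r where r: "emeasure lborel {0::real..} = ennreal r" "r \<ge> 0"
      by (cases "emeasure lborel {0::real..}") auto
    have "emeasure lborel {0..r+1} \<le> emeasure lborel {0::real..}"
      by (intro emeasure_mono) auto
    with r show False by (simp add: ennreal_le_iff)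
  qed
  moreover have "{t::real. 0 \<le> t \<and> ennreal t < y} = {0..}"
    using top by auto
  ultimately show ?thesis using top by simp
qed

text \<open>
  The region of \<open>s\<close> is the area under the graph of the density of \<open>A s\<close> with respect to a common
  dominating measure, so that the overlap of two regions is at least one minus the total
  variation distance.
\<close>

lemma density_regions_exist:
  fixes A :: "'s::countable \<Rightarrow> 'h measure"
  assumes A: "\<And>s. A s \<in> space (prob_algebra M)"
  obtains P R where "prob_space P" "sets P = sets M"
    "\<And>s. R s \<in> sets (P \<Otimes>\<^sub>M lborel)"
    "\<And>s E. E \<in> sets M \<Longrightarrow> emeasure (P \<Otimes>\<^sub>M lborel) (R s \<inter> E \<times> (UNIV :: real set)) = emeasure (A s) E"
    "\<And>s s'. ennreal (1 - tv_dist (A s) (A s')) \<le> emeasure (P \<Otimes>\<^sub>M lborel) (R s \<inter> R s')"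
proof -
  have setsA: "sets (A s) = sets M" and probA: "prob_space (A s)" for s
    using A[of s] by (auto simp: space_prob_algebra)
  \<comment> \<open>A geometric law pushed through \<open>from_nat\<close> charges every sample, so
    a null set of the mixture \<open>P\<close> is null for every \<open>A s\<close>.\<close>
  define p :: "'s pmf" where "p = map_pmf from_nat (geometric_pmf (1/2))"
  have "set_pmf p = UNIV"
    by (auto simp: p_def set_pmf_geometric)
  define P where "P = measure_pmf p \<bind> A"
  have Am: "A \<in> measure_pmf p \<rightarrow>\<^sub>M prob_algebra M"
    using A by simp
  have pp: "measure_pmf p \<in> space (prob_algebra (count_space UNIV))"
    by (simp add: space_prob_algebra measure_pmf.prob_space_axioms)
  have Am': "A \<in> count_space UNIV \<rightarrow>\<^sub>M prob_algebra M"
    using A by simp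
  have setsP: "sets P = sets M"
    unfolding P_def by (rule sets_bind) (auto simp: setsA)
  have probP: "prob_space P"
    unfolding P_def using prob_space_bind'[OF pp Am'] .
  interpret P: prob_space P by fact
  have emP: "emeasure P X = (\<integral>\<^sup>+s. emeasure (A s) X \<partial>measure_pmf p)" if "X \<in> sets M" for X
    unfolding P_def by (rule emeasure_bind_prob_algebra[OF pp Am' that])
  have ac: "absolutely_continuous P (A s)" for s
    unfolding absolutely_continuous_def
  proof
    fix X assume X: "X \<in> null_sets P"
    then have "X \<in> sets M" using setsP by auto
    from X emP[OF this] have "(\<integral>\<^sup>+s. emeasure (A s) X \<partial>measure_pmf p) = 0"
      by (auto simp: null_sets_def)
    then have "AE s in measure_pmf p. emeasure (A s) X = 0"
      by (subst (asm) nn_integral_0_iff_AE) auto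
    with \<open>set_pmf p = UNIV\<close> have "emeasure (A s) X = 0"
      by (auto simp: AE_measure_pmf_iff)
    with \<open>X \<in> sets M\<close> show "X \<in> null_sets (A s)"
      by (auto simp: null_sets_def setsA)
  qed
  define f where "f s = RN_deriv P (A s)" for s
  have f[measurable]: "f s \<in> borel_measurable P" for s
    by (simp add: f_def)
  have dens: "density P (f s) = A s" for s
    unfolding f_def by (rule P.density_RN_deriv) (use ac setsA setsP in auto)
  let ?\<mu> = "P \<Otimes>\<^sub>M (lborel :: real measure)"
  define R where "R s = {x \<in> space ?\<mu>. 0 \<le> snd x \<and> ennreal (snd x) < f s (fst x)}" for s
  have R[measurable]: "R s \<in> sets ?\<mu>" for s
    unfolding R_def by measurable
  have cyl: "E \<times> (UNIV :: real set) \<in> sets ?\<mu>" if "E \<in> sets M" for E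
    using that setsP by (intro pair_measureI) auto
  have emR: "emeasure ?\<mu> (R s \<inter> E \<times> (UNIV :: real set)) = emeasure (A s) E" if E: "E \<in> sets M" for s E
  proof -
    have "E \<subseteq> space P" using E setsP sets.sets_into_space by blast
    have "emeasure ?\<mu> (R s \<inter> E \<times> (UNIV :: real set))
        = (\<integral>\<^sup>+h. emeasure lborel (Pair h -` (R s \<inter> E \<times> (UNIV :: real set))) \<partial>P)"
      by (rule lborel.emeasure_pair_measure_alt[OF sets.Int[OF R cyl[OF E]]])
    also have "\<dots> = (\<integral>\<^sup>+h. f s h * indicator E h \<partial>P)"
    proof (rule nn_integral_cong)
      fix h assume "h \<in> space P"
      then have "Pair h -` (R s \<inter> E \<times> (UNIV :: real set))
          = (if h \<in> E then {t. 0 \<le> t \<and> ennreal t < f s h} else {})"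
        by (auto simp: R_def space_pair_measure)
      then show "emeasure lborel (Pair h -` (R s \<inter> E \<times> (UNIV :: real set))) = f s h * indicator E h"
        by (simp add: emeasure_lborel_below_ennreal)
    qed
    also have "\<dots> = emeasure (density P (f s)) E"
      by (rule emeasure_density[symmetric]) (use E setsP in auto)
    finally show ?thesis by (simp add: dens)
  qed
  have "ennreal (1 - tv_dist (A s) (A s')) \<le> emeasure ?\<mu> (R s \<inter> R s')" for s s'
  proof -
    interpret A: prob_space "A s" by (rule probA)
    interpret A': prob_space "A s'" by (rule probA)
    \<comment> \<open>The event on which the first density exceeds the second; the total variation
      distance is bounded below by testing on it.\<close>
    define E where "E = {h \<in> space P. f s' h < f s h}"
    have E: "E \<in> sets M"
      unfolding E_def setsP[symmetric] by measurable
    let ?U = "UNIV :: real set"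
    have spM: "space M = space P" using setsP by (metis sets_eq_imp_space_eq)
    have full: "R s \<inter> space M \<times> ?U = R s" for s
      by (auto simp: R_def space_pair_measure spM)
    have em1: "emeasure ?\<mu> (R s) = 1" for s
      using emR[of "space M" s] full[of s] prob_space.emeasure_space_1[OF probA[of s]]
        sets_eq_imp_space_eq[OF setsA[of s]] by simp
    have meas: "measure ?\<mu> (R s \<inter> E \<times> ?U) = measure (A s) E" for s
      using emR[OF E] by (simp add: measure_def)
    have fm: "R s \<in> fmeasurable ?\<mu>" for s
      by (rule fmeasurableI[OF R]) (simp add: em1)
    have fmE: "R s \<inter> E \<times> ?U \<in> fmeasurable ?\<mu>" for s
      using fm cyl[OF E] by (rule fmeasurable_Int_fmeasurable)
    \<comment> \<open>Off \<open>E\<close> the region of \<open>s\<close> lies inside that of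
      \<open>s'\<close>, so the difference lives over \<open>E\<close>. Over \<open>E\<close> the
      inclusion is reversed, so measures subtract.\<close>
    have "R s - R s \<inter> R s' = (R s \<inter> E \<times> ?U) - (R s' \<inter> E \<times> ?U)"
      by (auto simp: R_def E_def space_pair_measure)
    moreover have "R s' \<inter> E \<times> ?U \<subseteq> R s \<inter> E \<times> ?U"
      by (auto simp: R_def E_def)
    ultimately have "measure ?\<mu> (R s) - measure ?\<mu> (R s \<inter> R s') = measure (A s) E - measure (A s') E"
      using measurable_measure_Diff[OF fm, of "R s \<inter> R s'" s]
        measurable_measure_Diff[OF fmE, of "R s' \<inter> E \<times> ?U" s] meas fmE R cyl[OF E]
      by (auto simp: fmeasurableD)
    also have "\<dots> \<le> \<bar>measure (A s) E - measure (A s') E\<bar>" by simp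
    also have "\<dots> \<le> tv_dist (A s) (A s')"
      unfolding tv_dist_def
    proof (rule cSUP_upper)
      show "E \<in> sets (A s)" using E setsA by simp
      have "\<bar>measure (A s) E - measure (A s') E\<bar> \<le> 1" for E
        using A.prob_le_1[of E] A'.prob_le_1[of E] measure_nonneg[of "A s" E] measure_nonneg[of "A s'" E]
        by linarith
      then show "bdd_above ((\<lambda>E. \<bar>measure (A s) E - measure (A s') E\<bar>) ` sets (A s))"
        by (intro bdd_aboveI[of _ 1]) auto
    qed
    finally have "1 - tv_dist (A s) (A s') \<le> measure ?\<mu> (R s \<inter> R s')"
      using em1[of s] by (simp add: measure_def)
    moreover have "emeasure ?\<mu> (R s \<inter> R s') = ennreal (measure ?\<mu> (R s \<inter> R s'))"
      by (rule emeasure_eq_measure2[OF fmeasurable_Int_fmeasurable[OF fm R]])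
    ultimately show ?thesis by (simp add: ennreal_leI)
  qed
  with that[OF probP setsP R emR] show thesis by blast
qed

text \<open>Let \<open>q\<close> be the hit probability. Then \<open>q * q\<close> is at most 1 on
  \<open>G\<close>, at most \<open>c * q\<close> at good points outside \<open>G\<close>, and at
  most \<open>q\<close> at bad points. Integrating gives 1 - \<rho> \<le>
  \<open>emeasure \<mu> G\<close> + c + \<beta>, hence the lower bound. The upper bound is Markov's
  inequality, since \<open>q\<close> integrates to one.\<close>

lemma heavy_set:
  fixes p :: "'s::countable pmf" and R :: "'s \<Rightarrow> 'w set"
  assumes "sigma_finite_measure \<mu>" and R[measurable]: "\<And>s. R s \<in> sets \<mu>"
    and R1: "\<And>s. emeasure \<mu> (R s) = 1" and Good[measurable]: "Good \<in> sets \<mu>"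
    and overlap: "ennreal (1 - \<rho>) \<le> (\<integral>\<^sup>+s. \<integral>\<^sup>+s'. emeasure \<mu> (R s \<inter> R s') \<partial>measure_pmf p \<partial>measure_pmf p)"
    and bad: "(\<integral>\<^sup>+s. emeasure \<mu> (R s - Good) \<partial>measure_pmf p) \<le> ennreal \<beta>"
    and c: "c > 0" "2 * c \<le> 1 - \<rho> - \<beta>" and "\<beta> \<ge> 0"
  defines "G \<equiv> {x \<in> Good. c < measure_pmf.prob p {s. x \<in> R s}}"
  shows "G \<in> sets \<mu>" "ennreal c \<le> emeasure \<mu> G" "emeasure \<mu> G \<le> ennreal (1 / c)"
proof -
  define q where "q x = (\<integral>\<^sup>+s. indicator (R s) x \<partial>measure_pmf p)" for x
  have q_prob: "q x = ennreal (measure_pmf.prob p {s. x \<in> R s})" for x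
  proof -
    have "q x = (\<integral>\<^sup>+s. indicator {s. x \<in> R s} s \<partial>measure_pmf p)"
      unfolding q_def by (intro nn_integral_cong) (simp add: indicator_def)
    also have "\<dots> = emeasure (measure_pmf p) {s. x \<in> R s}" by simp
    finally show ?thesis by (simp add: measure_pmf.emeasure_eq_measure)
  qed
  have q_le: "q x \<le> 1" for x
    by (simp add: q_prob)
  have q_meas[measurable]: "q \<in> borel_measurable \<mu>"
    unfolding q_def by (rule borel_measurable_nn_integral_pmf) simp
  have [measurable]: "(\<lambda>x. measure_pmf.prob p {s. x \<in> R s}) \<in> borel_measurable \<mu>"
  proof (rule borel_measurable_prob_pmf)
    fix s
    have "{x \<in> space \<mu>. x \<in> R s} = R s" using sets.sets_into_space[OF R] by auto
    then show "{x \<in> space \<mu>. x \<in> R s} \<in> sets \<mu>" by simp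
  qed
  have sub: "Good \<subseteq> space \<mu>" using sets.sets_into_space[OF Good] .
  have "G = {x \<in> space \<mu>. x \<in> Good \<and> c < measure_pmf.prob p {s. x \<in> R s}}"
    using sub by (auto simp: G_def)
  also have "\<dots> \<in> sets \<mu>" by measurable
  finally show G[measurable]: "G \<in> sets \<mu>" .

  have int_q: "(\<integral>\<^sup>+x. q x * indicator B x \<partial>\<mu>) = (\<integral>\<^sup>+s. emeasure \<mu> (R s \<inter> B) \<partial>measure_pmf p)"
    if [measurable]: "B \<in> sets \<mu>" for B
  proof -
    have "(\<integral>\<^sup>+x. q x * indicator B x \<partial>\<mu>)
        = (\<integral>\<^sup>+x. \<integral>\<^sup>+s. indicator (R s \<inter> B) x \<partial>measure_pmf p \<partial>\<mu>)"
      unfolding q_def by (subst nn_integral_multc[symmetric]) (auto simp: indicator_inter_arith)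
    also have "\<dots> = (\<integral>\<^sup>+s. \<integral>\<^sup>+x. indicator (R s \<inter> B) x \<partial>\<mu> \<partial>measure_pmf p)"
      by (rule nn_integral_pmf_swap[symmetric, OF assms(1)]) simp
    finally show ?thesis by simp
  qed
  have q1: "(\<integral>\<^sup>+x. q x \<partial>\<mu>) = 1"
  proof -
    have "(\<integral>\<^sup>+x. q x \<partial>\<mu>) = (\<integral>\<^sup>+x. q x * indicator (space \<mu>) x \<partial>\<mu>)"
      by (intro nn_integral_cong) simp
    also have "\<dots> = 1"
      by (subst int_q) (simp_all add: R1 Int_absorb2 sets.sets_into_space[OF R])
    finally show ?thesis .
  qed
  have qbad: "(\<integral>\<^sup>+x. q x * indicator (space \<mu> - Good) x \<partial>\<mu>) \<le> ennreal \<beta>"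
  proof -
    have "R s \<inter> (space \<mu> - Good) = R s - Good" for s
      using sets.sets_into_space[OF R[of s]] by auto
    then show ?thesis using bad by (subst int_q) auto
  qed
  \<comment> \<open>By Tonelli, the expected overlap of two independently drawn regions is the
    integral of the squared hit probability.\<close>
  have qq: "(\<integral>\<^sup>+x. q x * q x \<partial>\<mu>) = (\<integral>\<^sup>+s. \<integral>\<^sup>+s'. emeasure \<mu> (R s \<inter> R s') \<partial>measure_pmf p \<partial>measure_pmf p)"
  proof -
    have "(\<integral>\<^sup>+s. \<integral>\<^sup>+s'. emeasure \<mu> (R s \<inter> R s') \<partial>measure_pmf p \<partial>measure_pmf p)
        = (\<integral>\<^sup>+s. \<integral>\<^sup>+x. q x * indicator (R s) x \<partial>\<mu> \<partial>measure_pmf p)"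
      by (intro nn_integral_cong) (simp add: int_q Int_commute)
    also have "\<dots> = (\<integral>\<^sup>+x. \<integral>\<^sup>+s. q x * indicator (R s) x \<partial>measure_pmf p \<partial>\<mu>)"
      by (rule nn_integral_pmf_swap[OF assms(1)]) simp
    also have "\<dots> = (\<integral>\<^sup>+x. q x * q x \<partial>\<mu>)"
      unfolding q_def[of x for x] by (intro nn_integral_cong) (simp add: nn_integral_cmult)
    finally show ?thesis by simp
  qed
  have "q x * q x \<le> indicator G x + (ennreal c * q x + q x * indicator (space \<mu> - Good) x)"
    if "x \<in> space \<mu>" for x
  proof -
    consider "x \<notin> Good" | "x \<in> G" | "x \<in> Good" "x \<notin> G" by blast
    then show ?thesis
    proof cases
      case 1
      have "q x * q x \<le> q x * 1" by (intro mult_left_mono q_le) simp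
      also have "\<dots> \<le> indicator G x + (ennreal c * q x + q x)" by simp
      finally show ?thesis using 1 that by simp
    next
      case 2
      have "q x * q x \<le> 1 * 1" by (intro mult_mono q_le) simp_all
      also have "\<dots> \<le> indicator G x + (ennreal c * q x + q x * indicator (space \<mu> - Good) x)"
        using 2 by simp
      finally show ?thesis .
    next
      case 3
      then have "q x \<le> ennreal c" unfolding q_prob G_def by (auto intro: ennreal_leI)
      then have "q x * q x \<le> ennreal c * q x" by (intro mult_right_mono) simp_all
      also have "\<dots> \<le> indicator G x + (ennreal c * q x + q x * indicator (space \<mu> - Good) x)"
        by (simp add: 3)
      finally show ?thesis .
    qed
  qed
  then have "(\<integral>\<^sup>+x. q x * q x \<partial>\<mu>)
      \<le> (\<integral>\<^sup>+x. indicator G x + (ennreal c * q x + q x * indicator (space \<mu> - Good) x) \<partial>\<mu>)"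
    by (intro nn_integral_mono) simp
  also have "\<dots> = emeasure \<mu> G + (ennreal c + (\<integral>\<^sup>+x. q x * indicator (space \<mu> - Good) x \<partial>\<mu>))"
    by (simp add: nn_integral_add nn_integral_cmult q1)
  also have "\<dots> \<le> emeasure \<mu> G + (ennreal c + ennreal \<beta>)"
    by (intro add_mono qbad order_refl)
  finally have main: "ennreal (1 - \<rho>) \<le> emeasure \<mu> G + ennreal (c + \<beta>)"
    using overlap qq c \<open>\<beta> \<ge> 0\<close> by (simp add: ennreal_plus)
  show "ennreal c \<le> emeasure \<mu> G"
  proof (cases "emeasure \<mu> G")
    case (real r)
    with main c \<open>\<beta> \<ge> 0\<close> have "1 - \<rho> \<le> r + (c + \<beta>)"
      by (simp add: ennreal_plus[symmetric] del: ennreal_plus)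
    with c real show ?thesis by (simp add: ennreal_leI)
  qed simp
  have "emeasure \<mu> G \<le> emeasure \<mu> {x \<in> space \<mu>. 1 \<le> ennreal (1 / c) * q x}"
  proof (intro emeasure_mono subsetI)
    fix x assume "x \<in> G"
    then have "1 \<le> (1 / c) * measure_pmf.prob p {s. x \<in> R s}"
      using c by (auto simp: G_def field_simps)
    then have "1 \<le> ennreal (1 / c) * q x"
      using c by (simp add: q_prob ennreal_mult[symmetric])
    with \<open>x \<in> G\<close> sub show "x \<in> {x \<in> space \<mu>. 1 \<le> ennreal (1 / c) * q x}"
      by (auto simp: G_def)
  qed simp
  also have "\<dots> \<le> ennreal (1 / c) * (\<integral>\<^sup>+x. q x * indicator (space \<mu>) x \<partial>\<mu>)"
    by (rule nn_integral_Markov_inequality) simp_all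
  also have "(\<integral>\<^sup>+x. q x * indicator (space \<mu>) x \<partial>\<mu>) = (\<integral>\<^sup>+x. q x \<partial>\<mu>)"
    by (intro nn_integral_cong) simp
  finally show "emeasure \<mu> G \<le> ennreal (1 / c)" by (simp add: q1)
qed

section \<open>Sampling proportionally to a weight\<close>

text \<open>Real-valued weights let the privacy estimate be carried out with Bochner integrals. The
  result is a probability measure once the weight is nonnegative and integrable with positive
  integral.\<close>

definition normalized :: "'w measure \<Rightarrow> ('w \<Rightarrow> real) \<Rightarrow> 'w measure" where
  "normalized M g = density M (\<lambda>x. ennreal (g x / (\<integral>x. g x \<partial>M)))"

lemma sets_normalized [simp, measurable_cong]: "sets (normalized M g) = sets M"
  by (simp add: normalized_def)

lemma space_normalized [simp]: "space (normalized M g) = space M"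
  by (simp add: normalized_def)

lemma emeasure_normalized:
  assumes g: "integrable M g" "\<And>x. 0 \<le> g x" "0 < (\<integral>x. g x \<partial>M)" and E: "E \<in> sets M"
  shows "emeasure (normalized M g) E = ennreal ((\<integral>x. g x * indicator E x \<partial>M) / (\<integral>x. g x \<partial>M))"
proof -
  let ?I = "\<integral>x. g x \<partial>M"
  have "emeasure (normalized M g) E = (\<integral>\<^sup>+x. ennreal (g x / ?I) * indicator E x \<partial>M)"
    unfolding normalized_def using g E by (intro emeasure_density) auto
  also have "\<dots> = (\<integral>\<^sup>+x. ennreal (g x * indicator E x / ?I) \<partial>M)"
    by (intro nn_integral_cong) (simp add: indicator_def)
  also have "\<dots> = ennreal (\<integral>x. g x * indicator E x / ?I \<partial>M)"
    using g E by (intro nn_integral_eq_integral integrable_divide integrable_real_mult_indicator AE_I2)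
      (auto intro!: divide_nonneg_pos)
  finally show ?thesis by simp
qed

lemma measure_normalized:
  assumes "integrable M g" "\<And>x. 0 \<le> g x" "0 < (\<integral>x. g x \<partial>M)" "E \<in> sets M"
  shows "measure (normalized M g) E = (\<integral>x. g x * indicator E x \<partial>M) / (\<integral>x. g x \<partial>M)"
  unfolding measure_def emeasure_normalized[OF assms]
  using assms by (intro enn2real_ennreal divide_nonneg_pos integral_nonneg_AE) auto

lemma prob_space_normalized:
  assumes g: "integrable M g" "\<And>x. 0 \<le> g x" "0 < (\<integral>x. g x \<partial>M)"
  shows "prob_space (normalized M g)"
proof
  have "(\<integral>x. g x * indicator (space M) x \<partial>M) = (\<integral>x. g x \<partial>M)"
    by (intro Bochner_Integration.integral_cong) auto
  with g show "emeasure (normalized M g) (space (normalized M g)) = 1"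
    by (simp add: emeasure_normalized)
qed

text \<open>
  Both the numerator and the normalising integral change by at most the additive term
  \<open>exp \<epsilon> - 1\<close>; the lower bound \<open>Z\<close> on the integrals turns it into \<open>\<delta> = exp (3 * \<epsilon>) / Z\<close>.
\<close>

lemma normalized_private:
  assumes g: "integrable M g" "\<And>x. 0 \<le> g x" "Z \<le> (\<integral>x. g x \<partial>M)"
    and g': "integrable M g'" "\<And>x. 0 \<le> g' x" "Z \<le> (\<integral>x. g' x \<partial>M)"
    and Z: "1 \<le> Z" and \<epsilon>: "0 \<le> \<epsilon>"
    and U: "U \<in> sets M" "emeasure M U = 1" and U': "U' \<in> sets M" "emeasure M U' = 1"
    and le: "\<And>x. g x \<le> exp \<epsilon> * g' x + (exp \<epsilon> - 1) * indicator U x"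
    and le': "\<And>x. g' x \<le> exp \<epsilon> * g x + (exp \<epsilon> - 1) * indicator U' x"
    and E: "E \<in> sets M"
  shows "measure (normalized M g) E \<le> exp (3 * \<epsilon>) * measure (normalized M g') E + exp (3 * \<epsilon>) / Z"
proof -
  define e where "e = exp \<epsilon>"
  have e: "1 \<le> e" using \<epsilon> by (simp add: e_def)
  define a where "a = (\<integral>x. g x * indicator E x \<partial>M)"
  define a' where "a' = (\<integral>x. g' x * indicator E x \<partial>M)"
  define b where "b = (\<integral>x. g x \<partial>M)"
  define b' where "b' = (\<integral>x. g' x \<partial>M)"
  have U_int: "integrable M (indicator V :: _ \<Rightarrow> real)" "(\<integral>x. indicator V x \<partial>M) = (1::real)"
    if "V \<in> sets M" "emeasure M V = 1" for V
    using that by (auto intro!: integrable_real_indicator simp: measure_def)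
  have gE: "integrable M (\<lambda>x. g x * indicator E x)" "integrable M (\<lambda>x. g' x * indicator E x)"
    using g g' E by (auto intro!: integrable_real_mult_indicator)
  have "0 \<le> a'" unfolding a'_def using g' by (intro integral_nonneg_AE) auto
  have "a \<le> (\<integral>x. e * (g' x * indicator E x) + (e - 1) * indicator U x \<partial>M)"
    unfolding a_def
  proof (rule integral_mono)
    fix x
    show "g x * indicator E x \<le> e * (g' x * indicator E x) + (e - 1) * indicator U x"
      using le[of x] e by (auto simp: e_def indicator_def)
  qed (use gE U_int(1)[OF U] in auto)
  also have "\<dots> = e * a' + (e - 1)"
    unfolding a'_def using gE U_int[OF U] by (subst Bochner_Integration.integral_add) auto
  finally have a: "a \<le> e * a' + (e - 1)" .
  have "b' \<le> (\<integral>x. e * g x + (e - 1) * indicator U' x \<partial>M)"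
    unfolding b'_def
  proof (rule integral_mono)
    fix x
    show "g' x \<le> e * g x + (e - 1) * indicator U' x"
      using le'[of x] by (simp add: e_def)
  qed (use g g' U_int(1)[OF U'] in auto)
  also have "\<dots> = e * b + (e - 1)"
    unfolding b_def using g U_int[OF U'] by (subst Bochner_Integration.integral_add) auto
  finally have b': "b' \<le> e * b + (e - 1)" .
  have bpos: "1 \<le> b" "1 \<le> b'" "Z \<le> b'" using g g' Z by (auto simp: b_def b'_def)
  \<comment> \<open>As \<open>e\<close> and \<open>b\<close> are at least one, the additive error is
    absorbed into a second factor \<open>e\<close> of the normalising integral.\<close>
  have "(e - 1) * 1 \<le> (e - 1) * (e * b)"
    using e bpos by (intro mult_left_mono) (auto intro: mult_ge1_I)
  with b' have "b' \<le> e\<^sup>2 * b" by (simp add: algebra_simps power2_eq_square)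
  then have "1 / b \<le> e\<^sup>2 / b'" using bpos by (simp add: field_simps)
  have "a / b \<le> (e * a' + (e - 1)) / b"
    using a bpos by (simp add: divide_right_mono)
  also have "\<dots> = (e * a' + (e - 1)) * (1 / b)" by simp
  also have "\<dots> \<le> (e * a' + (e - 1)) * (e\<^sup>2 / b')"
    using \<open>1 / b \<le> e\<^sup>2 / b'\<close> e \<open>0 \<le> a'\<close> by (intro mult_left_mono) auto
  also have "\<dots> = e ^ 3 * (a' / b') + (e - 1) * e\<^sup>2 / b'"
    by (simp add: algebra_simps power2_eq_square power3_eq_cube add_divide_distrib diff_divide_distrib)
  also have "(e - 1) * e\<^sup>2 / b' \<le> e ^ 3 / Z"
    using e bpos Z by (intro frac_le) (auto simp: power2_eq_square power3_eq_cube)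
  also have "e ^ 3 = exp (3 * \<epsilon>)"
    by (simp add: e_def exp_of_nat_mult[symmetric])
  finally have "a / b \<le> exp (3 * \<epsilon>) * (a' / b') + exp (3 * \<epsilon>) / Z" by simp
  then show ?thesis
    using g g' Z E by (simp add: measure_normalized a_def b_def a'_def b'_def)
qed

text \<open>
  The first summand only provides the lower bound \<open>Z\<close> on the total weight. The \<open>-1\<close> makes the
  weight of a point that lies in none of the regions vanish, so that the total weight stays
  finite although \<open>\<mu>\<close> may be infinite.
\<close>

definition wgt :: "real \<Rightarrow> real \<Rightarrow> 'w set \<Rightarrow> ('s \<Rightarrow> 'w set) \<Rightarrow> ('w \<Rightarrow> real) \<Rightarrow> 's list \<Rightarrow> 'w \<Rightarrow> real" where
  "wgt \<epsilon> Z D R w ss x = Z * indicator D x + (exp (\<epsilon> * length (filter (\<lambda>s. x \<in> R s) ss)) - 1) * w x"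

lemma wgt_nonneg: "0 \<le> \<epsilon> \<Longrightarrow> 0 \<le> Z \<Longrightarrow> 0 \<le> w x \<Longrightarrow> 0 \<le> wgt \<epsilon> Z D R w ss x"
  by (simp add: wgt_def)

section \<open>Integrability of the weight\<close>

lemma borel_measurable_length_filter:
  assumes [measurable]: "\<And>s. R s \<in> sets \<mu>"
  shows "(\<lambda>x. real (length (filter (\<lambda>s. x \<in> R s) ss))) \<in> borel_measurable \<mu>"
proof (induction ss)
  case (Cons s ss)
  have "(\<lambda>x. real (length (filter (\<lambda>s. x \<in> R s) (s # ss))))
      = (\<lambda>x. indicator (R s) x + real (length (filter (\<lambda>s. x \<in> R s) ss)))"
    by (auto simp: indicator_def)
  with Cons show ?case by simp
qed simp

text \<open>Each region has measure one, so the hit counts integrate to the number of samples, even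
  if \<mu> is infinite.\<close>

lemma nn_integral_length_filter:
  assumes [measurable]: "\<And>s. R s \<in> sets \<mu>" and "\<And>s. emeasure \<mu> (R s) = 1"
  shows "(\<integral>\<^sup>+x. ennreal (real (length (filter (\<lambda>s. x \<in> R s) ss))) \<partial>\<mu>) = ennreal (real (length ss))"
proof (induction ss)
  case (Cons s ss)
  note borel_measurable_length_filter[OF assms(1), measurable]
  have "(\<integral>\<^sup>+x. ennreal (real (length (filter (\<lambda>s. x \<in> R s) (s # ss)))) \<partial>\<mu>)
      = (\<integral>\<^sup>+x. indicator (R s) x + ennreal (real (length (filter (\<lambda>s. x \<in> R s) ss))) \<partial>\<mu>)"
    by (intro nn_integral_cong) (auto simp: indicator_def)
  also have "\<dots> = 1 + ennreal (real (length ss))"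
    by (subst nn_integral_add) (simp_all add: assms Cons.IH)
  finally show ?case using ennreal_plus[of 1 "real (length ss)"] by simp
qed simp

text \<open>With no hits both sides vanish; otherwise the count is at least one. Being linear in the
  number of hits, the bound is integrable.\<close>

lemma exp_hits_le:
  fixes \<epsilon> :: real
  assumes "0 \<le> \<epsilon>"
  shows "exp (\<epsilon> * length (filter Q ss)) - 1 \<le> exp (\<epsilon> * length ss) * real (length (filter Q ss))"
proof (cases "length (filter Q ss) = 0")
  case False
  have "exp (\<epsilon> * length (filter Q ss)) \<le> exp (\<epsilon> * length ss)"
    using assms by (simp add: mult_left_mono)
  then have "exp (\<epsilon> * length (filter Q ss)) - 1 \<le> exp (\<epsilon> * length ss) * 1"
    unfolding mult_1_right by linarith
  also have "\<dots> \<le> exp (\<epsilon> * length ss) * real (length (filter Q ss))"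
    using False by (intro mult_left_mono) (auto simp: Suc_le_eq)
  finally show ?thesis .
qed simp

text \<open>The weight is dominated by \<open>Z * indicator D x\<close> plus a constant times the
  hit count, both integrable. Its second summand is nonnegative, so the first alone contributes
  \<open>Z\<close> to the integral.\<close>

lemma
  assumes R[measurable]: "\<And>s. R s \<in> sets \<mu>" and R1: "\<And>s. emeasure \<mu> (R s) = 1"
    and D[measurable]: "D \<in> sets \<mu>" and D1: "emeasure \<mu> D = 1"
    and w[measurable]: "w \<in> borel_measurable \<mu>" and w01: "\<And>x. 0 \<le> w x" "\<And>x. w x \<le> 1"
    and \<epsilon>: "0 \<le> \<epsilon>" and Z: "0 \<le> Z"
  shows borel_measurable_wgt: "wgt \<epsilon> Z D R w ss \<in> borel_measurable \<mu>"
    and integrable_wgt: "integrable \<mu> (wgt \<epsilon> Z D R w ss)"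
    and integral_wgt_ge: "Z \<le> (\<integral>x. wgt \<epsilon> Z D R w ss x \<partial>\<mu>)"
proof -
  note borel_measurable_length_filter[OF R, measurable]
  show m[measurable]: "wgt \<epsilon> Z D R w ss \<in> borel_measurable \<mu>"
    unfolding wgt_def[abs_def] by measurable
  have D_int: "integrable \<mu> (\<lambda>x. Z * indicator D x)" "(\<integral>x. Z * indicator D x \<partial>\<mu>) = Z"
    using D1 by (auto intro!: integrable_real_indicator simp: measure_def)
  let ?h = "\<lambda>x. real (length (filter (\<lambda>s. x \<in> R s) ss))"
  have h_int: "integrable \<mu> ?h"
    by (rule integrableI_nonneg) (simp_all add: nn_integral_length_filter[OF R R1])
  show i: "integrable \<mu> (wgt \<epsilon> Z D R w ss)"
  proof (rule Bochner_Integration.integrable_bound)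
    show "integrable \<mu> (\<lambda>x. Z * indicator D x + exp (\<epsilon> * length ss) * ?h x)"
      using D_int h_int by auto
    have "(exp (\<epsilon> * ?h x) - 1) * w x \<le> (exp (\<epsilon> * length ss) * ?h x) * 1" for x
      using \<epsilon> w01 by (intro mult_mono exp_hits_le) auto
    then show "AE x in \<mu>. norm (wgt \<epsilon> Z D R w ss x) \<le> norm (Z * indicator D x + exp (\<epsilon> * length ss) * ?h x)"
      using \<epsilon> w01 Z by (simp add: wgt_def)
  qed simp
  have "(\<integral>x. Z * indicator D x \<partial>\<mu>) \<le> (\<integral>x. wgt \<epsilon> Z D R w ss x \<partial>\<mu>)"
    by (rule integral_mono[OF D_int(1) i]) (use \<epsilon> w01 in \<open>simp add: wgt_def\<close>)
  with D_int(2) show "Z \<le> (\<integral>x. wgt \<epsilon> Z D R w ss x \<partial>\<mu>)" by linarith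
qed

section \<open>Effect of changing one example\<close>

text \<open>The case of a change inside a block. One extra hit turns exp (\<epsilon> s') - 1 into
  exp \<epsilon> (exp (\<epsilon> s') - 1) + (exp \<epsilon> - 1), and the additive part arises only
  on the set \<open>U\<close> where a hit can be gained.\<close>

lemma wgt_le_of_hits_le:
  assumes "0 \<le> \<epsilon>" "0 \<le> Z" "0 \<le> w x" "w x \<le> 1"
    and hits: "length (filter (\<lambda>s. x \<in> R s) ss) \<le> length (filter (\<lambda>s. x \<in> R s) ss') + (if x \<in> U then 1 else 0)"
  shows "wgt \<epsilon> Z D R w ss x \<le> exp \<epsilon> * wgt \<epsilon> Z D R w ss' x + (exp \<epsilon> - 1) * indicator U x"
proof -
  let ?s = "real (length (filter (\<lambda>s. x \<in> R s) ss))" and ?s' = "real (length (filter (\<lambda>s. x \<in> R s) ss'))"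
  have e: "1 \<le> exp \<epsilon>" using assms by simp
  have Z: "Z * indicator D x \<le> exp \<epsilon> * (Z * indicator D x)"
    using mult_right_mono[OF e, of "Z * indicator D x"] assms by simp
  have "?s \<le> ?s' + indicator U x"
    using hits by (auto simp: indicator_def split: if_splits)
  then have "\<epsilon> * ?s \<le> \<epsilon> * (?s' + indicator U x)" using \<open>0 \<le> \<epsilon>\<close> by (rule mult_left_mono)
  then have "exp (\<epsilon> * ?s) \<le> exp (\<epsilon> * ?s') * exp (\<epsilon> * indicator U x)"
    by (simp add: exp_add[symmetric] algebra_simps)
  also have "\<dots> - 1 \<le> exp \<epsilon> * (exp (\<epsilon> * ?s') - 1) + (exp \<epsilon> - 1) * indicator U x"
    using mult_right_mono[OF e, of "exp (\<epsilon> * ?s') - 1"] assms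
    by (auto simp: indicator_def algebra_simps)
  finally have "exp (\<epsilon> * ?s) - 1 \<le> exp \<epsilon> * (exp (\<epsilon> * ?s') - 1) + (exp \<epsilon> - 1) * indicator U x"
    by simp
  then have "(exp (\<epsilon> * ?s) - 1) * w x
      \<le> (exp \<epsilon> * (exp (\<epsilon> * ?s') - 1) + (exp \<epsilon> - 1) * indicator U x) * w x"
    using assms by (intro mult_right_mono)
  also have "\<dots> = exp \<epsilon> * ((exp (\<epsilon> * ?s') - 1) * w x) + (exp \<epsilon> - 1) * indicator U x * w x"
    by (simp add: algebra_simps)
  also have "(exp \<epsilon> - 1) * indicator U x * w x \<le> (exp \<epsilon> - 1) * indicator U x"
    using e assms by (intro mult_left_le) auto
  finally show ?thesis using Z by (simp add: wgt_def distrib_left)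
qed

text \<open>The case of a change in the validation sample, where the loss is multiplicative. The
  additive term gives the bound the same shape as in the other case, so that one privacy estimate
  serves both.\<close>

lemma wgt_le_of_factor_le:
  assumes "0 \<le> \<epsilon>" "0 \<le> Z" "0 \<le> w' x" "w x \<le> exp \<epsilon> * w' x"
  shows "wgt \<epsilon> Z D R w ss x \<le> exp \<epsilon> * wgt \<epsilon> Z D R w' ss x + (exp \<epsilon> - 1) * indicator U x"
proof -
  have "Z * indicator D x \<le> exp \<epsilon> * (Z * indicator D x)"
    using mult_right_mono[of 1 "exp \<epsilon>" "Z * indicator D x"] assms by simp
  moreover have "(exp (\<epsilon> * length (filter (\<lambda>s. x \<in> R s) ss)) - 1) * w x
      \<le> (exp (\<epsilon> * length (filter (\<lambda>s. x \<in> R s) ss)) - 1) * (exp \<epsilon> * w' x)"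
    using assms by (intro mult_left_mono) auto
  moreover have "0 \<le> (exp \<epsilon> - 1) * indicator U x" using assms by simp
  ultimately show ?thesis by (simp add: wgt_def algebra_simps)
qed

text \<open>The only index that can satisfy \<open>Q\<close> in \<open>xs\<close> without doing so
  in \<open>ys\<close> is \<open>j\<close>.\<close>

lemma length_filter_le_of_eq_except:
  assumes "length xs = length ys" "\<And>i. i < length xs \<Longrightarrow> i \<noteq> j \<Longrightarrow> xs ! i = ys ! i"
  shows "length (filter Q xs) \<le> length (filter Q ys) + (if Q (xs ! j) then 1 else 0)"
proof -
  have "{i. i < length xs \<and> Q (xs ! i)}
      \<subseteq> {i. i < length ys \<and> Q (ys ! i)} \<union> (if Q (xs ! j) then {j} else {})"
  proof
    fix i assume "i \<in> {i. i < length xs \<and> Q (xs ! i)}"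
    then show "i \<in> {i. i < length ys \<and> Q (ys ! i)} \<union> (if Q (xs ! j) then {j} else {})"
      using assms by (cases "i = j") auto
  qed
  then have "card {i. i < length xs \<and> Q (xs ! i)}
      \<le> card ({i. i < length ys \<and> Q (ys ! i)} \<union> (if Q (xs ! j) then {j} else {}))"
    by (intro card_mono) auto
  also have "\<dots> \<le> card {i. i < length ys \<and> Q (ys ! i)} + card (if Q (xs ! j) then {j} else {})"
    by (rule card_Un_le)
  finally show ?thesis by (simp add: length_filter_conv_card split: if_splits)
qed

lemma blocks_nth_eq:
  assumes "length S = N" "length S' = N" "\<And>l. l < N \<Longrightarrow> l \<noteq> i \<Longrightarrow> S ! l = S' ! l"
    and "j < k" "j \<noteq> i div n" "0 < n"
  shows "blocks n k S ! j = blocks n k S' ! j"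
proof -
  have "take n (drop (j * n) S) = take n (drop (j * n) S')"
  proof (rule nth_equalityI)
    fix l assume l: "l < length (take n (drop (j * n) S))"
    then have "(j * n + l) div n = j" using \<open>0 < n\<close> by simp
    then have "j * n + l \<noteq> i" using assms by auto
    with l show "take n (drop (j * n) S) ! l = take n (drop (j * n) S') ! l"
      using assms by auto
  qed (use assms in auto)
  with \<open>j < k\<close> show ?thesis by (simp add: blocks_def)
qed

text \<open>An index from \<open>k * n\<close> on belongs to the validation part, beyond the last
  block.\<close>

lemma blocks_eq:
  assumes "length S = N" "length S' = N" "\<And>l. l < N \<Longrightarrow> l \<noteq> i \<Longrightarrow> S ! l = S' ! l" "k * n \<le> i"
  shows "blocks n k S = blocks n k S'"
  unfolding blocks_def
proof (intro map_cong refl nth_equalityI)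
  fix j l assume "j \<in> set [0..<k]" "l < length (take n (drop (j * n) S))"
  then have "j * n + n \<le> k * n"
    using mult_le_mono1[of "Suc j" k n] by (simp add: add.commute)
  with \<open>l < _\<close> have "j * n + l < i" "j * n \<le> N" "j * n + l < N"
    using assms by auto
  with \<open>l < _\<close> show "take n (drop (j * n) S) ! l = take n (drop (j * n) S') ! l"
    using assms(3)[of "j * n + l"] assms(1,2) by simp
qed (use assms in auto)

section \<open>Bounding the weight of bad hypotheses\<close>

text \<open>Call a point of \<open>G\<close> exceptional if it has at most \<open>N\<close> hits or
  its factor is below one. If the two exceptional sets have measures summing to at least
  \<open>c / 2\<close>, the first summand is at least one. Otherwise the rest of \<open>G\<close>
  has measure at least \<open>c / 2\<close> and weight at least exp (\<epsilon> N) - 1 at each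
  point, so the normalising integral is at least \<open>L\<close>. Adding the two bounds avoids
  conditioning when the expectation is taken.\<close>

lemma normalized_wgt_le:
  fixes \<epsilon> Z c :: real and N :: nat
  assumes R[measurable]: "\<And>s. R s \<in> sets \<mu>" and R1: "\<And>s. emeasure \<mu> (R s) = 1"
    and D[measurable]: "D \<in> sets \<mu>" and D1: "emeasure \<mu> D = 1"
    and w[measurable]: "w \<in> borel_measurable \<mu>" and w01: "\<And>x. 0 \<le> w x" "\<And>x. w x \<le> 1"
    and \<epsilon>: "0 < \<epsilon>" and Z: "0 < Z"
    and G[measurable]: "G \<in> sets \<mu>" and cG: "ennreal c \<le> emeasure \<mu> G" and Gfin: "emeasure \<mu> G < \<infinity>"
    and c: "0 < c" and N: "0 < N" and B[measurable]: "B \<in> sets \<mu>"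
  defines "L \<equiv> (exp (\<epsilon> * N) - 1) * (c / 2)"
  shows "emeasure (normalized \<mu> (wgt \<epsilon> Z D R w ss)) B
    \<le> ennreal (2 / c) * (emeasure \<mu> {x \<in> G. length (filter (\<lambda>s. x \<in> R s) ss) \<le> N}
          + emeasure \<mu> {x \<in> G. w x < 1})
      + ennreal (1 / L) * (ennreal Z + (\<integral>\<^sup>+x. ennreal ((exp (\<epsilon> * length (filter (\<lambda>s. x \<in> R s) ss)) - 1) * w x)
          * indicator B x \<partial>\<mu>))" (is "?lhs \<le> ennreal (2 / c) * (emeasure \<mu> ?K1 + emeasure \<mu> ?K2) + _ * (_ + ?J)")
proof -
  note borel_measurable_length_filter[OF R, measurable]
  let ?h = "\<lambda>x. real (length (filter (\<lambda>s. x \<in> R s) ss))"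
  let ?g = "wgt \<epsilon> Z D R w ss"
  have \<epsilon>0: "0 \<le> \<epsilon>" and Z0: "0 \<le> Z" using \<epsilon> Z by auto
  note g_meas[measurable] = borel_measurable_wgt[where R=R and w=w, OF R R1 D D1 w w01 \<epsilon>0 Z0]
  note g_int = integrable_wgt[where R=R and w=w, OF R R1 D D1 w w01 \<epsilon>0 Z0, where ss=ss]
  have g0: "0 \<le> ?g x" for x by (intro wgt_nonneg \<epsilon>0 Z0 w01)
  have gpos: "0 < (\<integral>x. ?g x \<partial>\<mu>)"
    using integral_wgt_ge[where R=R and w=w, OF R R1 D D1 w w01 \<epsilon>0 Z0, where ss=ss] Z by linarith
  interpret prob_space "normalized \<mu> ?g" by (rule prob_space_normalized[OF g_int g0 gpos])
  have L: "0 < L" using \<epsilon> N c by (simp add: L_def)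
  have Gsub: "G \<subseteq> space \<mu>" using sets.sets_into_space[OF G] .
  have K[measurable]: "?K1 \<in> sets \<mu>" "?K2 \<in> sets \<mu>"
  proof -
    have "?K1 = {x \<in> space \<mu>. x \<in> G \<and> ?h x \<le> real N}" using Gsub by auto
    also have "\<dots> \<in> sets \<mu>" by measurable
    finally show "?K1 \<in> sets \<mu>" .
    have "?K2 = {x \<in> space \<mu>. x \<in> G \<and> w x < 1}" using Gsub by auto
    also have "\<dots> \<in> sets \<mu>" by measurable
    finally show "?K2 \<in> sets \<mu>" .
  qed
  have fG: "G \<in> fmeasurable \<mu>" using Gfin by (intro fmeasurableI) auto
  have fK: "?K1 \<in> fmeasurable \<mu>" "?K2 \<in> fmeasurable \<mu>"
    by (rule fmeasurableI2[OF fG]; use K in auto)+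
  show ?thesis
  proof (cases "c / 2 \<le> measure \<mu> ?K1 + measure \<mu> ?K2")
    case True
    have "?lhs \<le> 1" by (rule emeasure_le_1)
    also have "(1::ennreal) \<le> ennreal ((2 / c) * (measure \<mu> ?K1 + measure \<mu> ?K2))"
      using True c by (simp add: field_simps)
    also have "\<dots> = ennreal (2 / c) * (emeasure \<mu> ?K1 + emeasure \<mu> ?K2)"
      using fK c by (simp add: emeasure_eq_measure2 ennreal_mult[symmetric] ennreal_plus[symmetric]
          distrib_left add_divide_distrib del: ennreal_plus)
    finally show ?thesis by (rule order_trans) simp
  next
    case False
    define G' where "G' = G - (?K1 \<union> ?K2)"
    have G'[measurable]: "G' \<in> sets \<mu>" unfolding G'_def by measurable
    have fG': "G' \<in> fmeasurable \<mu>"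
      by (rule fmeasurableI2[OF fG]) (auto simp: G'_def)
    have "c \<le> measure \<mu> G"
      using cG c fG by (simp add: emeasure_eq_measure2)
    also have "measure \<mu> G \<le> measure \<mu> (G' \<union> (?K1 \<union> ?K2))"
      by (intro measure_mono_fmeasurable fmeasurable.Un fG' fK) (auto simp: G'_def)
    also have "\<dots> \<le> measure \<mu> G' + (measure \<mu> ?K1 + measure \<mu> ?K2)"
      using fG' fK by (intro order_trans[OF measure_Un_le] add_left_mono measure_Un_le) auto
    finally have "c / 2 \<le> measure \<mu> G'" using False by simp
    have "L \<le> (exp (\<epsilon> * N) - 1) * measure \<mu> G'"
      unfolding L_def using \<open>c / 2 \<le> measure \<mu> G'\<close> \<epsilon> by (intro mult_left_mono) auto
    also have "\<dots> = (\<integral>x. (exp (\<epsilon> * N) - 1) * indicator G' x \<partial>\<mu>)"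
      using fG' by simp
    also have "\<dots> \<le> (\<integral>x. ?g x \<partial>\<mu>)"
    proof (rule integral_mono[OF _ g_int])
      show "integrable \<mu> (\<lambda>x. (exp (\<epsilon> * N) - 1) * indicator G' x)"
        using fG' by (auto intro!: integrable_real_indicator simp: fmeasurable_def)
      fix x
      show "(exp (\<epsilon> * N) - 1) * indicator G' x \<le> ?g x"
      proof (cases "x \<in> G'")
        case True
        then have "w x = 1" "real N \<le> ?h x" using w01(2)[of x] by (auto simp: G'_def)
        then have "exp (\<epsilon> * N) \<le> exp (\<epsilon> * ?h x)" "0 \<le> Z * indicator D x"
          using \<epsilon> Z by (auto simp: mult_left_mono)
        moreover have "(exp (\<epsilon> * N) - 1) * indicator G' x = exp (\<epsilon> * N) - 1"
          using True by simp
        moreover have "?g x = Z * indicator D x + exp (\<epsilon> * ?h x) - 1"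
          using \<open>w x = 1\<close> by (simp add: wgt_def)
        ultimately show ?thesis by linarith
      qed (use g0[of x] in simp)
    qed
    finally have LI: "L \<le> (\<integral>x. ?g x \<partial>\<mu>)" .
    have gB: "integrable \<mu> (\<lambda>x. ?g x * indicator B x)"
      using g_int by (intro integrable_real_mult_indicator) auto
    have gB0: "0 \<le> (\<integral>x. ?g x * indicator B x \<partial>\<mu>)"
      using g0 by (intro integral_nonneg_AE) auto
    have "?lhs = ennreal ((\<integral>x. ?g x * indicator B x \<partial>\<mu>) / (\<integral>x. ?g x \<partial>\<mu>))"
      by (rule emeasure_normalized[OF g_int g0 gpos B])
    also have "\<dots> \<le> ennreal (1 / L * (\<integral>x. ?g x * indicator B x \<partial>\<mu>))"
      using LI L gB0 by (intro ennreal_leI) (simp add: frac_le)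
    also have "\<dots> = ennreal (1 / L) * (\<integral>\<^sup>+x. ennreal (?g x * indicator B x) \<partial>\<mu>)"
      using ennreal_mult[OF _ gB0, of "1 / L"] nn_integral_eq_integral[OF gB] L g0 by simp
    also have "(\<integral>\<^sup>+x. ennreal (?g x * indicator B x) \<partial>\<mu>)
        \<le> (\<integral>\<^sup>+x. ennreal Z * indicator D x + ennreal ((exp (\<epsilon> * ?h x) - 1) * w x) * indicator B x \<partial>\<mu>)"
      using \<epsilon> Z w01 by (intro nn_integral_mono) (auto simp: wgt_def indicator_def)
    also have "\<dots> = ennreal Z + ?J"
      using D1 by (subst nn_integral_add) (auto simp: nn_integral_cmult)
    finally have "?lhs \<le> ennreal (1 / L) * (ennreal Z + ?J)"
      by (simp add: mult_left_mono)
    then show ?thesis by (rule order_trans) simp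
  qed
qed

text \<open>Exchanging the integrals turns a failure probability at each point into the expected
  measure of the failing part of \<open>G\<close>.\<close>

lemma nn_integral_pmf_emeasure_le:
  fixes p :: "'s::countable pmf"
  assumes "sigma_finite_measure \<mu>" and [measurable]: "G \<in> sets \<mu>" "\<And>s. {x \<in> G. Q s x} \<in> sets \<mu>"
    and le: "\<And>x. x \<in> G \<Longrightarrow> measure_pmf.prob p {s. Q s x} \<le> \<eta>"
  shows "(\<integral>\<^sup>+s. emeasure \<mu> {x \<in> G. Q s x} \<partial>measure_pmf p) \<le> ennreal \<eta> * emeasure \<mu> G"
proof -
  have "(\<integral>\<^sup>+s. emeasure \<mu> {x \<in> G. Q s x} \<partial>measure_pmf p)
      = (\<integral>\<^sup>+s. \<integral>\<^sup>+x. indicator {x \<in> G. Q s x} x \<partial>\<mu> \<partial>measure_pmf p)"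
    by simp
  also have "\<dots> = (\<integral>\<^sup>+x. \<integral>\<^sup>+s. indicator {x \<in> G. Q s x} x \<partial>measure_pmf p \<partial>\<mu>)"
    by (rule nn_integral_pmf_swap[OF assms(1)]) simp
  also have "\<dots> \<le> (\<integral>\<^sup>+x. ennreal \<eta> * indicator G x \<partial>\<mu>)"
  proof (rule nn_integral_mono)
    fix x
    have "(\<integral>\<^sup>+s. indicator {x \<in> G. Q s x} x \<partial>measure_pmf p)
        = (\<integral>\<^sup>+s. indicator G x * indicator {s. Q s x} s \<partial>measure_pmf p)"
      by (intro nn_integral_cong) (auto simp: indicator_def)
    also have "\<dots> = indicator G x * ennreal (measure_pmf.prob p {s. Q s x})"
      by (subst nn_integral_cmult) (simp_all add: measure_pmf.emeasure_eq_measure)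
    also have "\<dots> \<le> ennreal \<eta> * indicator G x"
      using le by (auto simp: indicator_def intro: ennreal_leI)
    finally show "(\<integral>\<^sup>+s. indicator {x \<in> G. Q s x} x \<partial>measure_pmf p) \<le> ennreal \<eta> * indicator G x" .
  qed
  also have "\<dots> = ennreal \<eta> * emeasure \<mu> G" by (simp add: nn_integral_cmult)
  finally show ?thesis .
qed

text \<open>The bound for fixed samples is averaged. Each exceptional set has expected measure at
  most \<eta> / c, which with the factor 2 / c accounts for 4 \<eta> / \<open>c\<^sup>2\<close>. The
  weight over \<open>B\<close> is averaged over the validation sample first, for fixed
  blocks.\<close>

lemma nn_integral_normalized_wgt_le:
  fixes \<epsilon> Z c \<eta> \<eta>' :: real and N :: nat and p :: "'s::countable pmf" and r :: "'t::countable pmf" and w :: "'t \<Rightarrow> 'w \<Rightarrow> real"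
  assumes \<mu>: "sigma_finite_measure \<mu>"
    and R[measurable]: "\<And>s. R s \<in> sets \<mu>" and R1: "\<And>s. emeasure \<mu> (R s) = 1"
    and D[measurable]: "D \<in> sets \<mu>" and D1: "emeasure \<mu> D = 1"
    and w[measurable]: "\<And>T. w T \<in> borel_measurable \<mu>"
    and w01: "\<And>T x. 0 \<le> w T x" "\<And>T x. w T x \<le> 1"
    and \<epsilon>: "0 < \<epsilon>" and Z: "0 < Z"
    and G[measurable]: "G \<in> sets \<mu>" and cG: "ennreal c \<le> emeasure \<mu> G" and Gfin: "emeasure \<mu> G \<le> ennreal (1 / c)"
    and c: "0 < c" and N: "0 < N" and B[measurable]: "B \<in> sets \<mu>"
    and hits: "\<And>x. x \<in> G \<Longrightarrow> measure_pmf.prob (replicate_pmf k p) {ss. length (filter (\<lambda>s. x \<in> R s) ss) \<le> N} \<le> \<eta>"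
    and good: "\<And>x. x \<in> G \<Longrightarrow> measure_pmf.prob r {T. w T x < 1} \<le> \<eta>"
    and bad: "\<And>x. x \<in> B \<Longrightarrow> (\<integral>\<^sup>+T. ennreal (w T x) \<partial>measure_pmf r) \<le> ennreal \<eta>'"
    and \<eta>: "0 \<le> \<eta>" "0 \<le> \<eta>'"
  defines "L \<equiv> (exp (\<epsilon> * N) - 1) * (c / 2)"
  shows "(\<integral>\<^sup>+ss. \<integral>\<^sup>+T. emeasure (normalized \<mu> (wgt \<epsilon> Z D R (w T) ss)) B \<partial>measure_pmf r \<partial>measure_pmf (replicate_pmf k p))
    \<le> ennreal (4 * \<eta> / c\<^sup>2 + (Z + exp (\<epsilon> * k) * k * \<eta>') / L)"
proof -
  note borel_measurable_length_filter[OF R, measurable]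
  let ?h = "\<lambda>ss x. real (length (filter (\<lambda>s. x \<in> R s) ss))"
  let ?K1 = "\<lambda>ss. emeasure \<mu> {x \<in> G. length (filter (\<lambda>s. x \<in> R s) ss) \<le> N}"
  let ?K2 = "\<lambda>T. emeasure \<mu> {x \<in> G. w T x < 1}"
  let ?J = "\<lambda>ss T. \<integral>\<^sup>+x. ennreal ((exp (\<epsilon> * ?h ss x) - 1) * w T x) * indicator B x \<partial>\<mu>"
  have L: "0 < L" using \<epsilon> N c by (simp add: L_def)
  have Gsub: "G \<subseteq> space \<mu>" using sets.sets_into_space[OF G] .
  have fin: "emeasure \<mu> G < \<infinity>" using Gfin by (simp add: order_le_less_trans)
  have K1: "(\<integral>\<^sup>+ss. ?K1 ss \<partial>measure_pmf (replicate_pmf k p)) \<le> ennreal \<eta> * emeasure \<mu> G"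
  proof (rule nn_integral_pmf_emeasure_le[OF \<mu> G _ hits])
    fix ss
    have "{x \<in> G. length (filter (\<lambda>s. x \<in> R s) ss) \<le> N} = {x \<in> space \<mu>. x \<in> G \<and> ?h ss x \<le> real N}"
      using Gsub by auto
    also have "\<dots> \<in> sets \<mu>" by measurable
    finally show "{x \<in> G. length (filter (\<lambda>s. x \<in> R s) ss) \<le> N} \<in> sets \<mu>" .
  qed
  have K2: "(\<integral>\<^sup>+T. ?K2 T \<partial>measure_pmf r) \<le> ennreal \<eta> * emeasure \<mu> G"
  proof (rule nn_integral_pmf_emeasure_le[OF \<mu> G _ good])
    fix T
    have "{x \<in> G. w T x < 1} = {x \<in> space \<mu>. x \<in> G \<and> w T x < 1}" using Gsub by auto
    also have "\<dots> \<in> sets \<mu>" by measurable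
    finally show "{x \<in> G. w T x < 1} \<in> sets \<mu>" .
  qed
  have J: "(\<integral>\<^sup>+T. ?J ss T \<partial>measure_pmf r) \<le> ennreal (exp (\<epsilon> * k) * k * \<eta>')"
    if "length ss = k" for ss
  proof -
    have "(\<integral>\<^sup>+T. ?J ss T \<partial>measure_pmf r)
        = (\<integral>\<^sup>+x. \<integral>\<^sup>+T. ennreal ((exp (\<epsilon> * ?h ss x) - 1) * w T x) * indicator B x \<partial>measure_pmf r \<partial>\<mu>)"
      by (rule nn_integral_pmf_swap[OF \<mu>]) simp
    \<comment> \<open>At each point of \<open>B\<close> the average factor is at most \<eta>', and
      the exponential is replaced by its bound linear in the hits, whose integral is
      \<open>k\<close>.\<close>
    also have "\<dots> \<le> (\<integral>\<^sup>+x. ennreal (exp (\<epsilon> * k) * \<eta>') * ennreal (?h ss x) \<partial>\<mu>)"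
    proof (rule nn_integral_mono)
      fix x
      let ?e = "exp (\<epsilon> * ?h ss x) - 1"
      have e0: "0 \<le> ?e" using \<epsilon> by simp
      have "(\<integral>\<^sup>+T. ennreal (?e * w T x) * indicator B x \<partial>measure_pmf r)
          = ennreal ?e * indicator B x * (\<integral>\<^sup>+T. ennreal (w T x) \<partial>measure_pmf r)"
        by (subst nn_integral_cmult[symmetric]) (use e0 w01 in \<open>auto simp: ennreal_mult ac_simps\<close>)
      also have "\<dots> \<le> ennreal ?e * ennreal \<eta>'"
        using bad by (auto simp: indicator_def intro: mult_left_mono)
      also have "\<dots> \<le> ennreal (exp (\<epsilon> * k) * ?h ss x) * ennreal \<eta>'"
        using exp_hits_le[of \<epsilon> "\<lambda>s. x \<in> R s" ss] \<epsilon> that by (intro mult_right_mono ennreal_leI) auto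
      also have "\<dots> = ennreal (exp (\<epsilon> * k) * \<eta>') * ennreal (?h ss x)"
        using \<eta> by (simp add: ennreal_mult[symmetric] ac_simps)
      finally show "(\<integral>\<^sup>+T. ennreal (?e * w T x) * indicator B x \<partial>measure_pmf r)
          \<le> ennreal (exp (\<epsilon> * k) * \<eta>') * ennreal (?h ss x)" .
    qed
    also have "\<dots> = ennreal (exp (\<epsilon> * k) * \<eta>') * ennreal (real k)"
      using nn_integral_length_filter[where R=R and ss=ss, OF R R1] that by (subst nn_integral_cmult) auto
    also have "\<dots> = ennreal (exp (\<epsilon> * k) * k * \<eta>')"
      using \<eta> by (simp add: ennreal_mult[symmetric] ac_simps)
    finally show ?thesis .
  qed
  have "(\<integral>\<^sup>+ss. \<integral>\<^sup>+T. emeasure (normalized \<mu> (wgt \<epsilon> Z D R (w T) ss)) B \<partial>measure_pmf r \<partial>measure_pmf (replicate_pmf k p))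
    \<le> (\<integral>\<^sup>+ss. \<integral>\<^sup>+T. ennreal (2 / c) * (?K1 ss + ?K2 T) + ennreal (1 / L) * (ennreal Z + ?J ss T)
        \<partial>measure_pmf r \<partial>measure_pmf (replicate_pmf k p))"
    unfolding L_def
    by (intro nn_integral_mono normalized_wgt_le[where R=R and w="w T" for T, OF R R1 D D1 w w01 \<epsilon> Z G cG fin c N B])
  also have "\<dots> = (\<integral>\<^sup>+ss. ennreal (2 / c) * (?K1 ss + (\<integral>\<^sup>+T. ?K2 T \<partial>measure_pmf r))
      + ennreal (1 / L) * (ennreal Z + (\<integral>\<^sup>+T. ?J ss T \<partial>measure_pmf r)) \<partial>measure_pmf (replicate_pmf k p))"
    by (simp add: nn_integral_add nn_integral_cmult)
  also have "\<dots> \<le> (\<integral>\<^sup>+ss. ennreal (2 / c) * (?K1 ss + ennreal \<eta> * emeasure \<mu> G)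
      + ennreal (1 / L) * (ennreal Z + ennreal (exp (\<epsilon> * k) * k * \<eta>')) \<partial>measure_pmf (replicate_pmf k p))"
    \<comment> \<open>Only lists of length \<open>k\<close> have positive probability, which is what
      the bound \<open>J\<close> requires.\<close>
    by (intro nn_integral_mono_AE AE_pmfI add_mono mult_left_mono K2 J order_refl)
      (auto simp: set_replicate_pmf)
  also have "\<dots> = ennreal (2 / c) * ((\<integral>\<^sup>+ss. ?K1 ss \<partial>measure_pmf (replicate_pmf k p)) + ennreal \<eta> * emeasure \<mu> G)
      + ennreal (1 / L) * (ennreal Z + ennreal (exp (\<epsilon> * k) * k * \<eta>'))"
    by (simp add: nn_integral_add nn_integral_cmult)
  also have "\<dots> \<le> ennreal (2 / c) * (ennreal \<eta> * ennreal (1 / c) + ennreal \<eta> * ennreal (1 / c))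
      + ennreal (1 / L) * (ennreal Z + ennreal (exp (\<epsilon> * k) * k * \<eta>'))"
    by (intro add_mono mult_left_mono order_refl order_trans[OF K1] Gfin) auto
  also have "\<dots> = ennreal ((2 / c) * (\<eta> * (1 / c) + \<eta> * (1 / c)) + (1 / L) * (Z + exp (\<epsilon> * k) * k * \<eta>'))"
    using c L Z \<eta> by (simp add: ennreal_mult[symmetric] ennreal_plus[symmetric] del: ennreal_plus)
  also have "(2 / c) * (\<eta> * (1 / c) + \<eta> * (1 / c)) + (1 / L) * (Z + exp (\<epsilon> * k) * k * \<eta>')
      = 4 * \<eta> / c\<^sup>2 + (Z + exp (\<epsilon> * k) * k * \<eta>') / L"
    by (simp add: power2_eq_square)
  finally show ?thesis .
qed

section \<open>Parameters and validation\<close>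

lemma eventually_exp_neg_le:
  fixes a \<eta> :: real
  assumes "0 < a" "0 < \<eta>"
  shows "eventually (\<lambda>m. exp (- a * real m) \<le> \<eta>) sequentially"
proof -
  have "exp (- a * real m) \<le> \<eta>" if "nat \<lceil>- ln \<eta> / a\<rceil> \<le> m" for m
  proof -
    have "- ln \<eta> / a \<le> real m" using that by linarith
    then have "- a * real m \<le> ln \<eta>" using assms by (simp add: field_simps)
    then show ?thesis using assms by (simp add: ln_ge_iff)
  qed
  then show ?thesis unfolding eventually_sequentially by blast
qed

text \<open>At least \<open>c * k\<close> hits are expected, and Hoeffding's inequality is applied
  with deviation c / 2. One \<open>k\<close> works for every \<open>p\<close>, as it must: the
  learner is fixed before the distribution is known.\<close>

lemma prob_hits_le_small:
  fixes c \<eta> :: real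
  assumes "0 < c" "0 < \<eta>"
  obtains k where "\<And>(p :: 's pmf) Q. c \<le> measure_pmf.prob p {s. Q s} \<Longrightarrow>
    measure_pmf.prob (replicate_pmf k p) {ss. length (filter Q ss) \<le> N} \<le> \<eta>"
proof -
  \<comment> \<open>Having k \<ge> 2 N / c puts \<open>N\<close> below half of the guaranteed
    expectation; the added one makes \<open>k\<close> positive.\<close>
  have "eventually (\<lambda>k. exp (- (c\<^sup>2 / 2) * real k) \<le> \<eta> \<and> nat \<lceil>2 * real N / c\<rceil> + 1 \<le> k) sequentially"
    using assms by (intro eventually_conj eventually_exp_neg_le eventually_ge_at_top) auto
  then obtain k where k: "exp (- (c\<^sup>2 / 2) * real k) \<le> \<eta>" "nat \<lceil>2 * real N / c\<rceil> + 1 \<le> k"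
    by (auto simp: eventually_sequentially)
  have "2 * real N / c \<le> real k" using k(2) by linarith
  then have N: "real N \<le> real k * c - c / 2 * real k"
    using assms by (simp add: field_simps)
  show thesis
  proof (rule that)
    fix p :: "'s pmf" and Q assume "c \<le> measure_pmf.prob p {s. Q s}"
    then have "real k * c \<le> real k * measure_pmf.prob p {s. Q s}" by (intro mult_left_mono) auto
    with N have "real N \<le> real k * measure_pmf.prob p {s. Q s} - c / 2 * real k" by linarith
    then have "measure_pmf.prob (replicate_pmf k p) {ss. real (length (filter Q ss)) \<le> real N}
        \<le> exp (- 2 * real k * (c / 2)\<^sup>2)"
      using assms k(2) by (intro prob_length_filter_le) auto
    also have "- 2 * real k * (c / 2)\<^sup>2 = - (c\<^sup>2 / 2) * real k" by (simp add: power2_eq_square)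
    finally show "measure_pmf.prob (replicate_pmf k p) {ss. length (filter Q ss) \<le> N} \<le> \<eta>"
      using k(1) by simp
  qed
qed

section \<open>The validation factor\<close>

text \<open>Truncation at the tolerance \<open>t\<close> gives hypotheses with at most
  \<open>t\<close> errors weight exactly one and keeps all weights at most one.\<close>

definition validation :: "real \<Rightarrow> real \<Rightarrow> ('a \<times> bool) list \<Rightarrow> ('a \<Rightarrow> bool) \<Rightarrow> real" where
  "validation \<epsilon> t T h = exp (- \<epsilon> * max 0 (real (length (filter (\<lambda>(x, y). h x \<noteq> y) T)) - t))"

lemma validation_nonneg: "0 \<le> validation \<epsilon> t T h"
  by (simp add: validation_def)

lemma validation_le_1: "0 \<le> \<epsilon> \<Longrightarrow> validation \<epsilon> t T h \<le> 1"
  by (simp add: validation_def)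

text \<open>One example changes the error count by at most one, and truncating at zero does not
  increase differences. More errors mean less weight, so the counts are compared in the opposite
  order.\<close>

lemma validation_le_of_eq_except:
  assumes "0 \<le> \<epsilon>" "length T = length T'" "\<And>i. i < length T \<Longrightarrow> i \<noteq> j \<Longrightarrow> T ! i = T' ! i"
  shows "validation \<epsilon> t T h \<le> exp \<epsilon> * validation \<epsilon> t T' h"
proof -
  let ?e = "\<lambda>T. real (length (filter (\<lambda>(x, y). h x \<noteq> y) T))"
  have "length (filter (\<lambda>(x, y). h x \<noteq> y) T') \<le> length (filter (\<lambda>(x, y). h x \<noteq> y) T)
      + (if (case T' ! j of (x, y) \<Rightarrow> h x \<noteq> y) then 1 else 0)"
    using assms by (intro length_filter_le_of_eq_except) auto
  then have "?e T' \<le> ?e T + 1" by (auto split: if_splits)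
  then have "\<epsilon> * max 0 (?e T' - t) \<le> \<epsilon> * (1 + max 0 (?e T - t))"
    using assms(1) by (intro mult_left_mono) auto
  then show ?thesis by (simp add: validation_def exp_add[symmetric] algebra_simps)
qed

lemma measurable_hyp_eval [measurable]: "(\<lambda>h. h x) \<in> measurable hyp_space (count_space UNIV)"
  unfolding hyp_space_def by (rule measurable_component_singleton) simp

lemma borel_measurable_validation: "validation \<epsilon> t T \<in> borel_measurable hyp_space"
proof -
  have "(\<lambda>h. real (length (filter (\<lambda>(x, y). h x \<noteq> y) T))) \<in> borel_measurable hyp_space"
  proof (induction T)
    case (Cons z T)
    obtain x y where z: "z = (x, y)" by (cases z)
    have "(\<lambda>h. real (length (filter (\<lambda>(x, y). h x \<noteq> y) (z # T))))
        = (\<lambda>h. (if h x \<noteq> y then 1 else 0) + real (length (filter (\<lambda>(x, y). h x \<noteq> y) T)))"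
      by (auto simp: z)
    also have "\<dots> \<in> borel_measurable hyp_space"
      using Cons by measurable
    finally show ?case .
  qed simp
  then show ?thesis unfolding validation_def[abs_def] by measurable
qed

lemma borel_measurable_err:
  fixes D :: "('a::countable \<times> bool) pmf"
  shows "err D \<in> borel_measurable hyp_space"
proof -
  have "(\<lambda>h. measure_pmf.prob D {s. case s of (x, y) \<Rightarrow> h x \<noteq> y}) \<in> borel_measurable hyp_space"
    by (intro borel_measurable_prob_pmf) (auto simp: split: prod.splits)
  then show ?thesis by (simp add: err_def[abs_def])
qed

text \<open>Hoeffding's inequality keeps good hypotheses below the tolerance and makes bad ones
  exceed it by an amount linear in \<open>m\<close>, where the factor is exponentially small. Both
  \<open>m\<close> and \<open>t\<close> are uniform in the distribution and the hypothesis.\<close>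

lemma validation_separates:
  fixes \<alpha> \<alpha>' \<epsilon> \<eta> :: real
  assumes "0 < \<alpha>'" "0 < \<epsilon>" "0 < \<eta>"
  obtains m t where
    "\<And>(D :: ('a \<times> bool) pmf) h. err D h \<le> \<alpha> \<Longrightarrow>
      measure_pmf.prob (replicate_pmf m D) {T. validation \<epsilon> t T h < 1} \<le> \<eta>"
    "\<And>(D :: ('a \<times> bool) pmf) h. \<alpha> + \<alpha>' < err D h \<Longrightarrow>
      (\<integral>\<^sup>+T. ennreal (validation \<epsilon> t T h) \<partial>measure_pmf (replicate_pmf m D)) \<le> ennreal \<eta>"
proof -
  \<comment> \<open>The margin is cut into thirds: one for the deviation of good hypotheses up to
    the tolerance, one for the excess that is penalised, one for the deviation of bad
    hypotheses.\<close>
  define b where "b = \<alpha>' / 3"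
  have b: "0 < b" using assms by (simp add: b_def)
  have "eventually (\<lambda>m. (exp (- (2 * b\<^sup>2) * real m) \<le> \<eta> / 2 \<and> exp (- (\<epsilon> * b) * real m) \<le> \<eta> / 2) \<and> 1 \<le> m) sequentially"
    using assms b by (intro eventually_conj eventually_exp_neg_le eventually_ge_at_top) auto
  then obtain m where m: "exp (- (2 * b\<^sup>2) * real m) \<le> \<eta> / 2" "exp (- (\<epsilon> * b) * real m) \<le> \<eta> / 2" "1 \<le> m"
    by (auto simp: eventually_sequentially)
  have m': "exp (- 2 * real m * b\<^sup>2) \<le> \<eta> / 2" using m(1) by (simp add: ac_simps)
  define t where "t = (\<alpha> + b) * real m"
  let ?e = "\<lambda>h T. real (length (filter (\<lambda>(x, y). h x \<noteq> y) T))"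
  have err: "err D h = measure_pmf.prob D {s. case s of (x, y) \<Rightarrow> h x \<noteq> y}" for D :: "('a \<times> bool) pmf" and h
    by (simp add: err_def)
  show thesis
  proof (rule that)
    fix D :: "('a \<times> bool) pmf" and h assume "err D h \<le> \<alpha>"
    then have "real m * err D h \<le> real m * \<alpha>" by (intro mult_left_mono) auto
    then have "measure_pmf.prob (replicate_pmf m D) {T. t \<le> ?e h T} \<le> exp (- 2 * real m * b\<^sup>2)"
      using m b by (intro prob_length_filter_ge) (auto simp: err t_def algebra_simps)
    moreover have "measure_pmf.prob (replicate_pmf m D) {T. validation \<epsilon> t T h < 1}
        \<le> measure_pmf.prob (replicate_pmf m D) {T. t \<le> ?e h T}"
      using assms by (intro measure_pmf.finite_measure_mono)
        (auto simp: validation_def zero_less_mult_iff max_def split: if_splits)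
    ultimately show "measure_pmf.prob (replicate_pmf m D) {T. validation \<epsilon> t T h < 1} \<le> \<eta>"
      using m' assms by linarith
  next
    fix D :: "('a \<times> bool) pmf" and h assume "\<alpha> + \<alpha>' < err D h"
    then have "real m * (\<alpha> + 3 * b) \<le> real m * err D h"
      by (intro mult_left_mono) (auto simp: b_def)
    then have P: "measure_pmf.prob (replicate_pmf m D) {T. ?e h T \<le> t + b * real m} \<le> exp (- 2 * real m * b\<^sup>2)"
      using m b by (intro prob_length_filter_le) (auto simp: err t_def algebra_simps)
    have "validation \<epsilon> t T h \<le> indicator {T. ?e h T \<le> t + b * real m} T + exp (- (\<epsilon> * b) * real m)" for T
    proof (cases "?e h T \<le> t + b * real m")
      case True
      then show ?thesis using validation_le_1[of \<epsilon> t T h] assms by (simp add: add_increasing2)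
    next
      case False
      then have "\<epsilon> * (b * real m) \<le> \<epsilon> * max 0 (?e h T - t)" using assms by (intro mult_left_mono) auto
      with False show ?thesis by (simp add: validation_def algebra_simps)
    qed
    then have "(\<integral>\<^sup>+T. ennreal (validation \<epsilon> t T h) \<partial>measure_pmf (replicate_pmf m D))
        \<le> (\<integral>\<^sup>+T. indicator {T. ?e h T \<le> t + b * real m} T + ennreal (exp (- (\<epsilon> * b) * real m)) \<partial>measure_pmf (replicate_pmf m D))"
      by (intro nn_integral_mono) (auto simp: ennreal_indicator[symmetric] ennreal_plus[symmetric] simp del: ennreal_plus intro!: ennreal_leI)
    also have "\<dots> = ennreal (measure_pmf.prob (replicate_pmf m D) {T. ?e h T \<le> t + b * real m}) + ennreal (exp (- (\<epsilon> * b) * real m))"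
      by (subst nn_integral_add) (auto simp: measure_pmf.emeasure_eq_measure)
    also have "\<dots> = ennreal (measure_pmf.prob (replicate_pmf m D) {T. ?e h T \<le> t + b * real m} + exp (- (\<epsilon> * b) * real m))"
      by (simp add: ennreal_plus)
    also have "\<dots> \<le> ennreal \<eta>"
      using P m' m(2) by (intro ennreal_leI) linarith
    finally show "(\<integral>\<^sup>+T. ennreal (validation \<epsilon> t T h) \<partial>measure_pmf (replicate_pmf m D)) \<le> ennreal \<eta>" .
  qed
qed

lemma tv_dist_bounds:
  assumes "prob_space M" "prob_space N"
  shows "0 \<le> tv_dist M N" "tv_dist M N \<le> 1"
proof -
  interpret M: prob_space M by fact
  interpret N: prob_space N by fact
  have le: "\<bar>measure M E - measure N E\<bar> \<le> 1" for E
    using M.prob_le_1[of E] N.prob_le_1[of E] measure_nonneg[of M E] measure_nonneg[of N E]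
    by linarith
  have "\<bar>measure M {} - measure N {}\<bar> \<le> tv_dist M N"
    unfolding tv_dist_def by (rule cSUP_upper) (auto intro!: bdd_aboveI[of _ 1] le)
  then show "0 \<le> tv_dist M N" by simp
  show "tv_dist M N \<le> 1"
    unfolding tv_dist_def by (rule cSUP_least) (auto intro: le)
qed

section \<open>The private learner\<close>

text \<open>The first \<open>k * n\<close> examples form the blocks and the rest validate.
  Projecting away the height coordinate is post-processing, which preserves privacy.\<close>

definition private_learner ::
  "nat \<Rightarrow> nat \<Rightarrow> real \<Rightarrow> real \<Rightarrow> real \<Rightarrow> (('a \<Rightarrow> bool) \<times> 'b) measure \<Rightarrow> (('a \<Rightarrow> bool) \<times> 'b) set
    \<Rightarrow> (('a \<times> bool) list \<Rightarrow> (('a \<Rightarrow> bool) \<times> 'b) set) \<Rightarrow> ('a \<times> bool) list \<Rightarrow> ('a \<Rightarrow> bool) measure" where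
  "private_learner n k \<epsilon> Z t \<mu> D R S = distr
    (normalized \<mu> (wgt \<epsilon> Z D R (\<lambda>x. validation \<epsilon> t (drop (k * n) S) (fst x)) (blocks n k S))) hyp_space fst"

context
  fixes n k :: nat and \<epsilon> Z t :: real and \<mu> :: "(('a::countable \<Rightarrow> bool) \<times> 'b) measure"
    and D :: "(('a \<Rightarrow> bool) \<times> 'b) set" and R :: "('a \<times> bool) list \<Rightarrow> (('a \<Rightarrow> bool) \<times> 'b) set"
  assumes R: "\<And>s. R s \<in> sets \<mu>" and R1: "\<And>s. emeasure \<mu> (R s) = 1"
    and D: "D \<in> sets \<mu>" and D1: "emeasure \<mu> D = 1"
    and fst_meas [measurable]: "fst \<in> measurable \<mu> hyp_space"
    and \<epsilon>: "0 < \<epsilon>" and Z: "1 \<le> Z"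
begin

private abbreviation weight :: "('a \<times> bool) list \<Rightarrow> ('a \<Rightarrow> bool) \<times> 'b \<Rightarrow> real" where
  "weight S \<equiv> wgt \<epsilon> Z D R (\<lambda>x. validation \<epsilon> t (drop (k * n) S) (fst x)) (blocks n k S)"

lemma weight_facts:
  shows "(\<lambda>x. validation \<epsilon> t T (fst x)) \<in> borel_measurable \<mu>"
    and "integrable \<mu> (weight S)" and "0 \<le> weight S x" and "Z \<le> (\<integral>x. weight S x \<partial>\<mu>)"
proof -
  show v: "(\<lambda>x. validation \<epsilon> t T (fst x)) \<in> borel_measurable \<mu>" for T
    using borel_measurable_validation by measurable
  show "integrable \<mu> (weight S)"
    using \<epsilon> Z by (intro integrable_wgt R R1 D D1 v validation_nonneg validation_le_1) auto
  show "Z \<le> (\<integral>x. weight S x \<partial>\<mu>)"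
    using \<epsilon> Z by (intro integral_wgt_ge R R1 D D1 v validation_nonneg validation_le_1) auto
  show "0 \<le> weight S x"
    using \<epsilon> Z by (intro wgt_nonneg validation_nonneg) auto
qed

lemma emeasure_private_learner:
  assumes "E \<in> sets hyp_space"
  shows "emeasure (private_learner n k \<epsilon> Z t \<mu> D R S) E
    = emeasure (normalized \<mu> (weight S)) (fst -` E \<inter> space \<mu>)"
  unfolding private_learner_def using assms by (subst emeasure_distr) auto

lemma private_learner_in_space: "private_learner n k \<epsilon> Z t \<mu> D R S \<in> space (prob_algebra hyp_space)"
proof -
  have "0 < (\<integral>x. weight S x \<partial>\<mu>)" using weight_facts(4)[of S] Z by linarith
  then interpret prob_space "normalized \<mu> (weight S)"
    by (intro prob_space_normalized weight_facts)
  show ?thesis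
    unfolding private_learner_def by (auto simp: space_prob_algebra intro!: prob_space_distr)
qed

text \<open>The changed example lies either in one block or in the validation part, so it alters
  either the hits of a single region or the validation factor, never both.\<close>

lemma private_learner_private:
  assumes S: "length S = N" "length S' = N" "card {i. i < N \<and> S ! i \<noteq> S' ! i} = 1"
    and E: "E \<in> sets hyp_space"
  shows "measure (private_learner n k \<epsilon> Z t \<mu> D R S) E
    \<le> exp (3 * \<epsilon>) * measure (private_learner n k \<epsilon> Z t \<mu> D R S') E + exp (3 * \<epsilon>) / Z"
proof -
  obtain i where i: "{i. i < N \<and> S ! i \<noteq> S' ! i} = {i}"
    using S(3) by (rule card_1_singletonE)
  have eq: "S ! l = S' ! l" "S' ! l = S ! l" if l: "l < N" "l \<noteq> i" for l
  proof -
    have "l \<notin> {i. i < N \<and> S ! i \<noteq> S' ! i}" unfolding i using l by simp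
    with l(1) show "S ! l = S' ! l" "S' ! l = S ! l" by simp_all
  qed
  \<comment> \<open>Stated for arbitrary \<open>S\<close> and \<open>S'\<close>, since the estimate
    is applied in both directions.\<close>
  have "\<exists>U\<in>sets \<mu>. emeasure \<mu> U = 1 \<and>
      (\<forall>x. weight S x \<le> exp \<epsilon> * weight S' x + (exp \<epsilon> - 1) * indicator U x)"
    if S: "length S = N" "length S' = N" and eq: "\<And>l. l < N \<Longrightarrow> l \<noteq> i \<Longrightarrow> S ! l = S' ! l" for S S'
  proof (cases "k * n \<le> i")
    case True
    have blocks: "blocks n k S = blocks n k S'" by (rule blocks_eq[OF S eq True])
    have "validation \<epsilon> t (drop (k * n) S) h \<le> exp \<epsilon> * validation \<epsilon> t (drop (k * n) S') h" for h
    proof (rule validation_le_of_eq_except)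
      fix l assume "l < length (drop (k * n) S)" "l \<noteq> i - k * n"
      then show "drop (k * n) S ! l = drop (k * n) S' ! l"
        using S eq[of "k * n + l"] True by auto
    qed (use S \<epsilon> in auto)
    \<comment> \<open>Any set of measure one can play the part of \<open>U\<close> here;
      \<open>D\<close> is at hand.\<close>
    then have "weight S x \<le> exp \<epsilon> * weight S' x + (exp \<epsilon> - 1) * indicator D x" for x
      unfolding blocks using \<epsilon> Z by (intro wgt_le_of_factor_le validation_nonneg) auto
    with D D1 show ?thesis by blast
  next
    case False
    then have "0 < n" by (cases n) auto
    have drop: "drop (k * n) S = drop (k * n) S'"
      using S eq False by (intro nth_equalityI) auto
    let ?j = "i div n"
    have "length (filter (\<lambda>s. x \<in> R s) (blocks n k S))
        \<le> length (filter (\<lambda>s. x \<in> R s) (blocks n k S')) + (if x \<in> R (blocks n k S ! ?j) then 1 else 0)" for x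
    proof (rule length_filter_le_of_eq_except)
      fix j assume "j < length (blocks n k S)" "j \<noteq> ?j"
      then show "blocks n k S ! j = blocks n k S' ! j"
        by (intro blocks_nth_eq[OF S eq]) (auto simp: blocks_def \<open>0 < n\<close>)
    qed (simp add: blocks_def)
    \<comment> \<open>\<open>S\<close> can gain a hit only on the region of its own changed block,
      which has measure one.\<close>
    then have "weight S x \<le> exp \<epsilon> * weight S' x + (exp \<epsilon> - 1) * indicator (R (blocks n k S ! ?j)) x" for x
      unfolding drop using \<epsilon> Z by (intro wgt_le_of_hits_le validation_nonneg validation_le_1) auto
    with R R1 show ?thesis by blast
  qed
  from this[OF S(1,2) eq(1)] this[OF S(2,1) eq(2)] obtain U U' where
    U: "U \<in> sets \<mu>" "emeasure \<mu> U = 1"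
      "\<And>x. weight S x \<le> exp \<epsilon> * weight S' x + (exp \<epsilon> - 1) * indicator U x"
    and U': "U' \<in> sets \<mu>" "emeasure \<mu> U' = 1"
      "\<And>x. weight S' x \<le> exp \<epsilon> * weight S x + (exp \<epsilon> - 1) * indicator U' x"
    by blast
  show ?thesis
    unfolding measure_def[of "private_learner _ _ _ _ _ _ _ _ _"] emeasure_private_learner[OF E]
      measure_def[symmetric]
    by (rule normalized_private[OF weight_facts(2,3,4) weight_facts(2,3,4) Z _ U(1,2) U'(1,2) U(3) U'(3)])
      (use \<epsilon> E in auto)
qed

end

theorem theorem4:
  fixes H :: "('a::countable \<Rightarrow> bool) set"
    and \<rho> \<alpha> \<beta> \<alpha>' \<beta>' \<epsilon> \<delta> :: real
  assumes "\<rho> \<in> {0<..<1}"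
    and "\<alpha> \<in> {0<..<1/2}"
    and "\<beta> \<in> {0<..<(1 - \<rho>) / (1 + \<rho>)}"
    and "\<exists>n A. learner n A \<and> accurate n \<alpha> \<beta> H A \<and> tv_indistinguishable n \<rho> A"
    and "\<alpha>' \<in> {0<..<1}" and "\<beta>' \<in> {0<..<1}" and "\<epsilon> \<in> {0<..<1}" and "\<delta> \<in> {0<..<1}"
  shows "\<exists>n' A'. learner n' A' \<and> accurate n' (\<alpha> + \<alpha>') \<beta>' H A' \<and> diff_private n' \<epsilon> \<delta> A'"
proof -
  obtain n A where A: "learner n A" "accurate n \<alpha> \<beta> H A" "tv_indistinguishable n \<rho> A"
    using assms(4) by blast
  \<comment> \<open>Half of the gap between the overlap 1 - \<rho> and the bad mass \<beta>. The gap
    is positive because (1 - \<rho>) / (1 + \<rho>) is at most 1 - \<rho>.\<close>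
  define c where "c = (1 - \<rho> - \<beta>) / 2"
  have "(1 - \<rho>) / (1 + \<rho>) \<le> (1 - \<rho>) / 1"
    using assms(1) by (intro divide_left_mono) auto
  then have c: "0 < c" "2 * c \<le> 1 - \<rho> - \<beta>" and "0 \<le> \<beta>"
    using assms(3) by (auto simp: c_def)

  \<comment> \<open>\<open>learner\<close> constrains lists of length \<open>n\<close> only, while
    the density regions are built for all lists; other lengths get the output on a fixed list of
    length \<open>n\<close>.\<close>
  define A0 where "A0 s = (if length s = n then A s else A (replicate n undefined))" for s
  have A0: "A0 s \<in> space (prob_algebra hyp_space)" for s
    using A(1) by (auto simp: A0_def learner_def)
  have setsA0: "sets (A0 s) = sets hyp_space" and probA0: "prob_space (A0 s)" for s
    using A0[of s] by (auto simp: space_prob_algebra)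
  obtain P R where probP: "prob_space P" and setsP: "sets P = sets hyp_space"
    and R: "\<And>s. R s \<in> sets (P \<Otimes>\<^sub>M lborel)"
    and emR: "\<And>s E. E \<in> sets hyp_space \<Longrightarrow>
      emeasure (P \<Otimes>\<^sub>M lborel) (R s \<inter> E \<times> (UNIV :: real set)) = emeasure (A0 s) E"
    and overlap: "\<And>s s'. ennreal (1 - tv_dist (A0 s) (A0 s')) \<le> emeasure (P \<Otimes>\<^sub>M lborel) (R s \<inter> R s')"
    by (rule density_regions_exist[of A0 hyp_space, OF A0], rule that; assumption)
  define \<mu> where "\<mu> = P \<Otimes>\<^sub>M (lborel :: real measure)"
  note R = R[folded \<mu>_def] and emR = emR[folded \<mu>_def] and overlap = overlap[folded \<mu>_def]
  interpret P: prob_space P by fact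
  interpret pair_sigma_finite P "lborel :: real measure" ..
  have \<mu>: "sigma_finite_measure \<mu>" unfolding \<mu>_def ..
  have spP: "space P = space hyp_space" using setsP by (rule sets_eq_imp_space_eq)
  have space_hyp: "space hyp_space = (UNIV :: ('a \<Rightarrow> bool) set)"
    by (simp add: hyp_space_def space_PiM)
  have space_\<mu>: "space \<mu> = UNIV" by (simp add: \<mu>_def space_pair_measure spP space_hyp)
  have fst_\<mu> [measurable]: "fst \<in> measurable \<mu> hyp_space"
    unfolding \<mu>_def by (rule measurable_compose[OF measurable_fst]) (simp add: setsP measurable_ident_sets)
  have UNIV_hyp: "(UNIV :: ('a \<Rightarrow> bool) set) \<in> sets hyp_space"
    using sets.top[of "hyp_space :: ('a \<Rightarrow> bool) measure"] by (simp only: space_hyp)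
  have R1: "emeasure \<mu> (R s) = 1" for s
    using emR[OF UNIV_hyp, of s] prob_space.emeasure_space_1[OF probA0[of s]]
      sets_eq_imp_space_eq[OF setsA0[of s]] by (simp add: space_hyp)
  \<comment> \<open>Up to a null set, the region under the constant density one: the first summand
    of the weight amounts to drawing from \<open>P\<close>, independently of the data.\<close>
  define D0 where "D0 = space P \<times> {0..1::real}"
  have D0: "D0 \<in> sets \<mu>" unfolding D0_def \<mu>_def by simp
  have D01: "emeasure \<mu> D0 = 1"
    unfolding D0_def \<mu>_def by (subst lborel.emeasure_pair_measure_Times) (simp_all add: P.emeasure_space_1)

  \<comment> \<open>Heavy good points for a realizable distribution\<close>
  \<comment> \<open>The set \<open>G\<close> depends on the distribution, but \<mu>, the regions and
    \<open>c\<close> do not, so the private learner can be defined without knowing it.\<close>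
  have heavy: "\<exists>G\<in>sets \<mu>. ennreal c \<le> emeasure \<mu> G \<and> emeasure \<mu> G \<le> ennreal (1 / c) \<and>
      (\<forall>x\<in>G. err D (fst x) \<le> \<alpha> \<and> c \<le> measure_pmf.prob (replicate_pmf n D) {s. x \<in> R s})"
    if D: "realizable H D" for D
  proof -
    let ?p = "replicate_pmf n D"
    note borel_measurable_err[of D, measurable]
    define B where "B = {h \<in> space hyp_space. \<alpha> < err D h}"
    have B[measurable]: "B \<in> sets hyp_space" unfolding B_def by measurable
    define Good where "Good = {x \<in> space \<mu>. err D (fst x) \<le> \<alpha>}"
    have Good: "Good \<in> sets \<mu>" unfolding Good_def by measurable
    have eqA: "A0 s = A s" if "s \<in> set_pmf ?p" for s
      using that by (simp add: A0_def set_replicate_pmf)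
    have ov: "ennreal (1 - \<rho>) \<le> (\<integral>\<^sup>+s. \<integral>\<^sup>+s'. emeasure \<mu> (R s \<inter> R s') \<partial>measure_pmf ?p \<partial>measure_pmf ?p)"
    proof -
      let ?pp = "pair_pmf ?p ?p"
      let ?tv = "\<lambda>z. tv_dist (A0 (fst z)) (A0 (snd z))"
      have tv: "0 \<le> ?tv z" "?tv z \<le> 1" for z by (rule tv_dist_bounds[OF probA0 probA0])+
      have int: "integrable (measure_pmf ?pp) ?tv"
        by (rule measure_pmf.integrable_const_bound[where B=1]) (use tv in auto)
      have "measure_pmf.expectation ?pp ?tv
          = measure_pmf.expectation ?pp (\<lambda>(S, S'). tv_dist (A S) (A S'))"
        by (intro integral_cong_AE AE_pmfI) (auto simp: eqA)
      also have "\<dots> \<le> \<rho>" using A(3) by (simp add: tv_indistinguishable_def)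
      finally have "1 - \<rho> \<le> measure_pmf.expectation ?pp (\<lambda>z. 1 - ?tv z)"
        using int by simp
      then have "ennreal (1 - \<rho>) \<le> ennreal (measure_pmf.expectation ?pp (\<lambda>z. 1 - ?tv z))"
        by (rule ennreal_leI)
      also have "\<dots> = (\<integral>\<^sup>+z. ennreal (1 - ?tv z) \<partial>measure_pmf ?pp)"
        using int tv by (intro nn_integral_eq_integral[symmetric]) auto
      also have "\<dots> \<le> (\<integral>\<^sup>+z. emeasure \<mu> (R (fst z) \<inter> R (snd z)) \<partial>measure_pmf ?pp)"
        by (intro nn_integral_mono overlap)
      finally show ?thesis by (simp add: nn_integral_pair_pmf')
    qed
    have bad: "(\<integral>\<^sup>+s. emeasure \<mu> (R s - Good) \<partial>measure_pmf ?p) \<le> ennreal \<beta>"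
    proof -
      \<comment> \<open>Goodness depends only on the hypothesis, so the part of a region over bad
        points has the mass that \<open>A0 s\<close> gives to bad hypotheses.\<close>
      have "R s - Good = R s \<inter> B \<times> UNIV" for s
        by (auto simp: Good_def B_def space_\<mu> space_hyp)
      then have "(\<integral>\<^sup>+s. emeasure \<mu> (R s - Good) \<partial>measure_pmf ?p) = (\<integral>\<^sup>+s. ennreal (measure (A0 s) B) \<partial>measure_pmf ?p)"
        by (simp add: emR[OF B] finite_measure.emeasure_eq_measure[OF prob_space.finite_measure[OF probA0]])
      also have "\<dots> = ennreal (measure_pmf.expectation ?p (\<lambda>s. measure (A0 s) B))"
        by (intro nn_integral_eq_integral measure_pmf.integrable_const_bound[where B=1])
          (auto simp: prob_space.prob_le_1[OF probA0])
      also have "measure_pmf.expectation ?p (\<lambda>s. measure (A0 s) B)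
          = measure_pmf.expectation ?p (\<lambda>S. measure (A S) {h \<in> space (A S). err D h > \<alpha>})"
        by (intro integral_cong_AE AE_pmfI)
          (auto simp: B_def eqA[symmetric] sets_eq_imp_space_eq[OF setsA0])
      also have "ennreal \<dots> \<le> ennreal \<beta>"
        using A(2) D by (intro ennreal_leI) (simp add: accurate_def)
      finally show ?thesis .
    qed
    show ?thesis
      by (rule bexI[OF _ heavy_set(1)[OF \<mu> R R1 Good ov bad c \<open>0 \<le> \<beta>\<close>]])
        (use heavy_set(2,3)[OF \<mu> R R1 Good ov bad c \<open>0 \<le> \<beta>\<close>] in \<open>auto simp: Good_def\<close>)
  qed

  \<comment> \<open>Choice of the parameters, in the order \<open>Z\<close>, \<open>N\<close>,
    \<open>k\<close>, \<open>m\<close>\<close>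
  \<comment> \<open>With \<open>e\<close> equal to \<epsilon> / 3 the additive privacy loss is exp
    \<epsilon> / Z, at most 3 / Z = \<delta> because \<epsilon> < 1.\<close>
  define Z where "Z = 3 / \<delta>"
  define e where "e = \<epsilon> / 3"
  have Z: "1 \<le> Z" and e: "0 < e" using assms by (auto simp: Z_def e_def field_simps)
  \<comment> \<open>Makes the exceptional term 4 \<eta> / \<open>c\<^sup>2\<close> equal to half of
    \<beta>'.\<close>
  define \<eta> where "\<eta> = \<beta>' * c\<^sup>2 / 8"
  have \<eta>: "0 < \<eta>" using assms c by (simp add: \<eta>_def)
  \<comment> \<open>Via exp x - 1 \<ge> x this makes \<open>L\<close> so large that (Z + 1) / L is
    below the other half of \<beta>'.\<close>
  obtain N :: nat where N: "4 * (Z + 1) / (\<beta>' * c * e) < real N" using reals_Archimedean2 by blast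
  have "0 < 4 * (Z + 1) / (\<beta>' * c * e)" using Z assms c e by simp
  then have N0: "0 < N" using N by (cases N) auto
  define L where "L = (exp (e * N) - 1) * (c / 2)"
  have eN: "e * N \<le> exp (e * N) - 1" using exp_ge_add_one_self[of "e * N"] by linarith
  have "4 * (Z + 1) < real N * (\<beta>' * c * e)"
    using N assms c e by (simp add: pos_divide_less_eq)
  also have "\<dots> = 2 * \<beta>' * ((e * N) * (c / 2))" by simp
  also have "\<dots> \<le> 2 * \<beta>' * L"
    unfolding L_def using eN assms(6) c by (intro mult_left_mono mult_right_mono) auto
  finally have L: "2 * (Z + 1) < \<beta>' * L" by simp
  have "0 < 2 * (Z + 1)" using Z by simp
  then have "0 < \<beta>' * L" using L by (rule less_trans)
  then have L0: "0 < L" by (rule zero_less_mult_pos) (use assms in auto)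
  obtain k where k: "\<And>(p :: ('a \<times> bool) list pmf) Q. c \<le> measure_pmf.prob p {s. Q s} \<Longrightarrow>
      measure_pmf.prob (replicate_pmf k p) {ss. length (filter Q ss) \<le> N} \<le> \<eta>"
    using prob_hits_le_small[OF c(1) \<eta>] by blast
  \<comment> \<open>Chosen after \<open>k\<close>, so that long validation can beat the weight exp
    (e k) that \<open>k\<close> hits can produce; k + 1 keeps the denominator positive.\<close>
  define \<eta>' where "\<eta>' = min \<eta> (1 / (exp (e * k) * (k + 1)))"
  have \<eta>'0: "0 < \<eta>'" using \<eta> by (simp add: \<eta>'_def)
  have "exp (e * k) * k * \<eta>' \<le> exp (e * k) * (k + 1) * (1 / (exp (e * k) * (k + 1)))"
    by (intro mult_mono) (use \<eta> in \<open>auto simp: \<eta>'_def\<close>)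
  also have "\<dots> = 1" by simp
  finally have \<eta>'k: "exp (e * k) * k * \<eta>' \<le> 1" .
  have "0 < \<alpha>'" using assms by simp
  obtain m t where
    good: "\<And>(D :: ('a \<times> bool) pmf) h. err D h \<le> \<alpha> \<Longrightarrow>
      measure_pmf.prob (replicate_pmf m D) {T. validation e t T h < 1} \<le> \<eta>'" and
    bad: "\<And>(D :: ('a \<times> bool) pmf) h. \<alpha> + \<alpha>' < err D h \<Longrightarrow>
      (\<integral>\<^sup>+T. ennreal (validation e t T h) \<partial>measure_pmf (replicate_pmf m D)) \<le> ennreal \<eta>'"
    using validation_separates[OF \<open>0 < \<alpha>'\<close> e \<eta>'0, of \<alpha>] by blast
  let ?A = "private_learner n k e Z t \<mu> D0 R"
  have sp: "?A S \<in> space (prob_algebra hyp_space)" for S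
    by (rule private_learner_in_space[OF R R1 D0 D01 fst_\<mu> e Z])
  have "learner (k * n + m) ?A" using sp by (simp add: learner_def)

  \<comment> \<open>Privacy of the constructed learner\<close>
  moreover have "diff_private (k * n + m) \<epsilon> \<delta> ?A"
    unfolding diff_private_def
  proof (intro allI impI ballI)
    fix S S' :: "('a \<times> bool) list" and E :: "('a \<Rightarrow> bool) set"
    assume S: "length S = k * n + m" "length S' = k * n + m"
      "card {i. i < k * n + m \<and> S ! i \<noteq> S' ! i} = 1" and E: "E \<in> sets hyp_space"
    have "measure (?A S) E \<le> exp (3 * e) * measure (?A S') E + exp (3 * e) / Z"
      by (rule private_learner_private[OF R R1 D0 D01 fst_\<mu> e Z S E])
    also have "exp (3 * e) / Z \<le> 3 / Z"
      using exp_le exp_le_cancel_iff[of "3 * e" 1] assms Z by (intro divide_right_mono) (auto simp: e_def simp del: exp_le_cancel_iff)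
    finally show "measure (?A S) E \<le> exp \<epsilon> * measure (?A S') E + \<delta>"
      by (simp add: e_def Z_def)
  qed

  \<comment> \<open>Accuracy of the constructed learner\<close>
  moreover have "accurate (k * n + m) (\<alpha> + \<alpha>') \<beta>' H ?A"
    unfolding accurate_def
  proof (intro allI impI)
    fix D assume D: "realizable H D"
    obtain G where G: "G \<in> sets \<mu>" "ennreal c \<le> emeasure \<mu> G" "emeasure \<mu> G \<le> ennreal (1 / c)"
      "\<And>x. x \<in> G \<Longrightarrow> err D (fst x) \<le> \<alpha>"
      "\<And>x. x \<in> G \<Longrightarrow> c \<le> measure_pmf.prob (replicate_pmf n D) {s. x \<in> R s}"
      using heavy[OF D] by blast
    note borel_measurable_err[of D, measurable]
    define E where "E = {h \<in> space hyp_space. \<alpha> + \<alpha>' < err D h}"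
    have E: "E \<in> sets hyp_space" unfolding E_def by measurable
    define B where "B = fst -` E \<inter> space \<mu>"
    have B: "B \<in> sets \<mu>" unfolding B_def using E by (rule measurable_sets[OF fst_\<mu>])
    let ?w = "\<lambda>T x. validation e t T (fst x)"
    let ?F = "\<lambda>(ss, T). emeasure (normalized \<mu> (wgt e Z D0 R (?w T) ss)) B"
    have FA: "ennreal (measure (?A S) {h \<in> space (?A S). \<alpha> + \<alpha>' < err D h}) = ?F (blocks n k S, drop (k * n) S)" for S
    proof -
      interpret prob_space "?A S" using sp[of S] by (simp add: space_prob_algebra)
      have "{h \<in> space (?A S). \<alpha> + \<alpha>' < err D h} = E"
        using sp[of S] by (simp add: E_def space_prob_algebra sets_eq_imp_space_eq[of "?A S" hyp_space])
      then show ?thesis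
        using emeasure_private_learner[where R=R and S=S and n=n and k=k and t=t, OF R R1 D0 D01 fst_\<mu> e Z E]
        by (simp add: emeasure_eq_measure[symmetric] B_def)
    qed
    have "(\<integral>\<^sup>+S. ennreal (measure (?A S) {h \<in> space (?A S). \<alpha> + \<alpha>' < err D h}) \<partial>measure_pmf (replicate_pmf (k * n + m) D))
        = (\<integral>\<^sup>+z. ?F z \<partial>measure_pmf (map_pmf (\<lambda>S. (blocks n k S, drop (k * n) S)) (replicate_pmf (k * n + m) D)))"
      unfolding FA by simp
    \<comment> \<open>Blocks and validation sample are independent, so the expectation becomes an
      iterated integral.\<close>
    also have "\<dots> = (\<integral>\<^sup>+ss. \<integral>\<^sup>+T. emeasure (normalized \<mu> (wgt e Z D0 R (?w T) ss)) B
        \<partial>measure_pmf (replicate_pmf m D) \<partial>measure_pmf (replicate_pmf k (replicate_pmf n D)))"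
      unfolding replicate_pmf_blocks by (simp add: nn_integral_pair_pmf')
    also have "\<dots> \<le> ennreal (4 * \<eta> / c\<^sup>2 + (Z + exp (e * k) * k * \<eta>') / L)"
      unfolding L_def
    proof (rule nn_integral_normalized_wgt_le[OF \<mu> R R1 D0 D01 _ _ _ e _ G(1-3) c(1) N0 B])
      show "?w T \<in> borel_measurable \<mu>" for T
        by (rule weight_facts(1)[OF R R1 D0 D01 fst_\<mu> e Z])
      fix x assume x: "x \<in> G"
      show "measure_pmf.prob (replicate_pmf k (replicate_pmf n D)) {ss. length (filter (\<lambda>s. x \<in> R s) ss) \<le> N} \<le> \<eta>"
        using G(5)[OF x] by (rule k)
      show "measure_pmf.prob (replicate_pmf m D) {T. ?w T x < 1} \<le> \<eta>"
        using good[OF G(4)[OF x]] by (simp add: \<eta>'_def)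
    next
      fix x assume "x \<in> B"
      then show "(\<integral>\<^sup>+T. ennreal (?w T x) \<partial>measure_pmf (replicate_pmf m D)) \<le> ennreal \<eta>'"
        by (intro bad) (simp add: B_def E_def)
    qed (use Z e \<eta> \<eta>'0 in \<open>auto simp: validation_nonneg validation_le_1\<close>)
    also have "\<dots> \<le> ennreal \<beta>'"
    proof (rule ennreal_leI)
      have "4 * \<eta> / c\<^sup>2 = \<beta>' / 2" using c by (simp add: \<eta>_def)
      moreover have "(Z + exp (e * k) * k * \<eta>') / L \<le> (Z + 1) / L"
        using \<eta>'k L0 by (intro divide_right_mono) auto
      moreover have "(Z + 1) / L \<le> \<beta>' / 2" using L L0 by (simp add: field_simps)
      ultimately show "4 * \<eta> / c\<^sup>2 + (Z + exp (e * k) * k * \<eta>') / L \<le> \<beta>'" by linarith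
    qed
    finally show "measure_pmf.expectation (replicate_pmf (k * n + m) D)
        (\<lambda>S. measure (?A S) {h \<in> space (?A S). \<alpha> + \<alpha>' < err D h}) \<le> \<beta>'"
      using assms by (intro integral_real_bounded) auto
  qed
  ultimately show ?thesis by blast
qed

end
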